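(* Let $n\ge 1$, let $\mathbf{l}=(l_1,\ldots,l_n)$ be an ordered tuple of positive integers, put $l=l_1+\cdots+l_n$, and let $\mathbf{l}^\vee=(l_n,l_{n-1},\ldots,l_1)$ be its reverse. For each of the two types $\ddagger\in\{*,\mathrm{sh}\}$ of regularized multiple zeta values, $$\zeta^{\ddagger}(\mathbf{l})\equiv(-1)^{l-1}\,\zeta^{\ddagger}(\mathbf{l}^\vee)\pmod{\mathcal{Z}_l^{(n-1)}+\mathcal{P}_l}.$$ In particular, one obtains the parity result: if $l+n$ is odd, then $$\zeta^{\ddagger}(l_1,\ldots,l_n)\equiv 0\pmod{\mathcal{Z}_l^{(<n)}+\mathcal{P}_l}.$$
   Context: Multiple zeta values (MZVs): for positive integers $l_1,\ldots,l_n$ with $n\ge1$, $l_1\ge2$, $\zeta(l_1,\ldots,l_n)=\sum_{m_1>\cdots>m_n>0}\frac{1}{m_1^{l_1}\cdots m_n^{l_n}}$; its weight is $l_1+\cdots+l_n$ and its depth is $n$. Vector spaces (all $\mathbb{Q}$-subspaces of $\mathbb{R}$): $\mathcal{Z}_l^{(d)}$ is the $\mathbb{Q}$-span of all MZVs of weight $l$ and depth $d$ (the zero space if there are none, e.g. $d=0$); $\mathcal{Z}_l^{(<n)}=\sum_{d=1}^{n-1}\mathcal{Z}_l^{(d)}$; $\mathcal{P}_l$ is the $\mathbb{Q}$-span of all products of two or more MZVs of total weight $l$ together with the single zeta value $\zeta(l)$ (when $l\ge2$). For a subspace $V$, $a\equiv b \pmod V$ means $a-b\in V$. Regularized multiple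 zeta values (RMZVs): Let $\mathfrak{H}=\mathbb{Q}\langle x,y\rangle$ be the non-commutative polynomial algebra, $\mathfrak{H}^1=\mathbb{Q}+\mathfrak{H}y$, $\mathfrak{H}^0=\mathbb{Q}+x\mathfrak{H}y$, and $z_k=x^{k-1}y$ for $k\ge1$; $\mathfrak{H}^1$ is freely generated by the $z_k$. The harmonic product $*$ on $\mathfrak{H}^1$ is the $\mathbb{Q}$-bilinear product with $1*w=w*1=w$ and $z_kw_1*z_lw_2=z_k(w_1*z_lw_2)+z_l(z_kw_1*w_2)+z_{k+l}(w_1*w_2)$ for words $w,w_1,w_2\in\mathfrak{H}^1$. The shuffle product $\mathrm{sh}$ is the $\mathbb{Q}$-bilinear product with $1\,\mathrm{sh}\,w=w\,\mathrm{sh}\,1=w$ and $uw_1\,\mathrm{sh}\,vw_2=u(w_1\,\mathrm{sh}\,vw_2)+v(uw_1\,\mathrm{sh}\,w_2)$ for letters $u,v\in\{x,y\}$ and words $w,w_1,w_2$. Both make $\mathfrak{H}^1$ a commutative $\mathbb{Q}$-algebra with subalgebra $\mathfrak{H}^0$, denoted $\mathfrak{H}^1_*\supset\mathfrak{H}^0_*$ and $\mathfrak{H}^1_{\mathrm{sh}}\supset\mathfrak{H}^0_{\mathrm{sh}}$, and $\mathfrak{H}^1_*\simeq\mathfrak{H}^0_*[y]$, $\mathfrak{H}^1_{\mathrm{sh}}\simeq\mathfrak{H}^0_{\mathrm{sh}}[y]$. The $\mathbb{Q}$-linear evaluation map $Z:\mathfrak{H}^0\to\mathbb{R}$, $Z(1)=1$,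 $Z(z_{l_1}\cdots z_{l_n})=\zeta(l_1,\ldots,l_n)$, is a homomorphism for both products. Let $Z^*:\mathfrak{H}^1_*\to\mathbb{R}[T]$ and $Z^{\mathrm{sh}}:\mathfrak{H}^1_{\mathrm{sh}}\to\mathbb{R}[T]$ be the unique algebra homomorphisms extending $Z$ and sending $y$ to $T$. For any positive integers $l_1,\ldots,l_n$, the harmonic-type value $\zeta^*(l_1,\ldots,l_n)$ and the shuffle-type value $\zeta^{\mathrm{sh}}(l_1,\ldots,l_n)$ are the values at $T=0$ of $Z^*(z_{l_1}\cdots z_{l_n})$ and $Z^{\mathrm{sh}}(z_{l_1}\cdots z_{l_n})$ respectively. *)

theory Defs
  imports
    "HOL-Analysis.Analysis"
    "HOL-Library.Poly_Mapping"
    "HOL-Library.Set_Algebras"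
    "HOL-Computational_Algebra.Polynomial"
begin

section \<open>Multiple zeta values\<close>

text \<open>The index tuple \<open>(l\<^sub>1, \<dots>, l\<^sub>n)\<close> is a list; its depth is \<^const>\<open>length\<close>, its weight
  \<^const>\<open>sum_list\<close>.\<close>

definition admissible :: "nat list \<Rightarrow> bool" where
  "admissible ls \<longleftrightarrow> ls \<noteq> [] \<and> (\<forall>k\<in>set ls. 1 \<le> k) \<and> 2 \<le> hd ls"

text \<open>For the empty tuple the value is \<open>1\<close>, which is the convention \<open>Z(1) = 1\<close> below.\<close>

definition mzv :: "nat list \<Rightarrow> real" where
  "mzv ls = (\<Sum>\<^sub>\<infinity>ms\<in>{ms. length ms = length ls \<and> sorted_wrt (>) ms \<and> (\<forall>m\<in>set ms. 0 < m)}.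
     1 / (\<Prod>i<length ls. real (ms ! i) ^ (ls ! i)))"


section \<open>Rational subspaces of the reals\<close>

interpretation rat_real: vector_space "\<lambda>(q::rat) (x::real). of_rat q * x"
  by unfold_locales (auto simp: algebra_simps of_rat_add of_rat_mult)

definition Zspace :: "nat \<Rightarrow> nat \<Rightarrow> real set" where
  "Zspace l d = rat_real.span {mzv ls | ls. admissible ls \<and> sum_list ls = l \<and> length ls = d}"

text \<open>The sum is the Minkowski sum of subspaces; the empty sum is \<open>{0}\<close>.\<close>

definition Zspace_less :: "nat \<Rightarrow> nat \<Rightarrow> real set" where
  "Zspace_less l n = (\<Sum>d\<in>{1..<n}. Zspace l d)"

definition Pspace :: "nat \<Rightarrow> real set" where
  "Pspace l = rat_real.span
     ({\<Prod>ls\<leftarrow>Ls. mzv ls | Ls.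
         2 \<le> length Ls \<and> (\<forall>ls\<in>set Ls. admissible ls) \<and> (\<Sum>ls\<leftarrow>Ls. sum_list ls) = l}
      \<union> {mzv [k] | k. k = l \<and> 2 \<le> k})"

definition cong_mod :: "real \<Rightarrow> real \<Rightarrow> real set \<Rightarrow> bool" where
  "cong_mod a b V \<longleftrightarrow> a - b \<in> V"


section \<open>The algebra of non-commutative polynomials\<close>

text \<open>Words form the free monoid under concatenation. Written additively, this makes
  finitely supported functions on words with their convolution product the algebra
  \<open>\<rat>\<langle>x, y\<rangle>\<close>.\<close>

instantiation list :: (type) monoid_add
begin
definition zero_list :: "'a list" where "zero_list = []"
definition plus_list :: "'a list \<Rightarrow> 'a list \<Rightarrow> 'a list" where "plus_list = (@)"
instance by standard (simp_all add: zero_list_def plus_list_def)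
end

datatype letter = Letter_x | Letter_y

type_synonym ncpoly = "letter list \<Rightarrow>\<^sub>0 rat"

definition word :: "letter list \<Rightarrow> ncpoly" where
  "word w = Poly_Mapping.single w 1"

definition scalar :: "rat \<Rightarrow> ncpoly" where
  "scalar c = Poly_Mapping.single [] c"

definition nc_x :: ncpoly where "nc_x = word [Letter_x]"
definition nc_y :: ncpoly where "nc_y = word [Letter_y]"

definition zgen :: "nat \<Rightarrow> ncpoly" where
  "zgen k = nc_x ^ (k - 1) * nc_y"

definition H1 :: "ncpoly set" where
  "H1 = {scalar c + p * nc_y | c p. True}"

definition H0 :: "ncpoly set" where
  "H0 = {scalar c + nc_x * p * nc_y | c p. True}"

text \<open>The tuple \<open>(k\<^sub>1, \<dots>, k\<^sub>n)\<close> with \<open>w = z\<^bsub>k\<^sub>1\<^esub> \<cdots> z\<^bsub>k\<^sub>n\<^esub>\<close>, for a word \<open>w\<close> of \<^const>\<open>H1\<close>. The first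
  argument of \<open>index_aux\<close> counts the letters \<open>x\<close> read since the last \<open>y\<close>. (On words ending in
  \<open>x\<close>, which are not in \<^const>\<open>H1\<close>, the final \<open>x\<close>'s are ignored.)\<close>

fun index_aux :: "nat \<Rightarrow> letter list \<Rightarrow> nat list" where
  "index_aux j [] = []"
| "index_aux j (Letter_x # w) = index_aux (Suc j) w"
| "index_aux j (Letter_y # w) = Suc j # index_aux 0 w"

definition index_of :: "letter list \<Rightarrow> nat list" where
  "index_of w = index_aux 0 w"

definition bilinear_ext :: "(letter list \<Rightarrow> letter list \<Rightarrow> ncpoly) \<Rightarrow> ncpoly \<Rightarrow> ncpoly \<Rightarrow> ncpoly" where
  "bilinear_ext f p q =
     (\<Sum>u\<in>Poly_Mapping.keys p. \<Sum>v\<in>Poly_Mapping.keys q.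
        scalar (Poly_Mapping.lookup p u * Poly_Mapping.lookup q v) * f u v)"


section \<open>Harmonic and shuffle products\<close>

text \<open>\<open>harmonic_index ks ls\<close> is \<open>z\<^bsub>k\<^sub>1\<^esub> \<cdots> z\<^bsub>k\<^sub>m\<^esub> * z\<^bsub>l\<^sub>1\<^esub> \<cdots> z\<^bsub>l\<^sub>n\<^esub>\<close>.\<close>

fun harmonic_index :: "nat list \<Rightarrow> nat list \<Rightarrow> ncpoly" where
  "harmonic_index [] ls = (\<Prod>l\<leftarrow>ls. zgen l)"
| "harmonic_index (k # ks) [] = (\<Prod>l\<leftarrow>k # ks. zgen l)"
| "harmonic_index (k # ks) (l # ls) =
     zgen k * harmonic_index ks (l # ls) + zgen l * harmonic_index (k # ks) ls
     + zgen (k + l) * harmonic_index ks ls"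

text \<open>Only meaningful on \<^const>\<open>H1\<close>.\<close>

definition harmonic :: "ncpoly \<Rightarrow> ncpoly \<Rightarrow> ncpoly" where
  "harmonic = bilinear_ext (\<lambda>u v. harmonic_index (index_of u) (index_of v))"

fun shuffle_word :: "letter list \<Rightarrow> letter list \<Rightarrow> ncpoly" where
  "shuffle_word [] w = word w"
| "shuffle_word (a # u) [] = word (a # u)"
| "shuffle_word (a # u) (b # v) =
     word [a] * shuffle_word u (b # v) + word [b] * shuffle_word (a # u) v"

definition shuffle :: "ncpoly \<Rightarrow> ncpoly \<Rightarrow> ncpoly" where
  "shuffle = bilinear_ext shuffle_word"


section \<open>Regularized multiple zeta values\<close>

text \<open>Only meaningful on \<^const>\<open>H0\<close>.\<close>

definition Zeval :: "ncpoly \<Rightarrow> real" where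
  "Zeval p = (\<Sum>w\<in>Poly_Mapping.keys p. of_rat (Poly_Mapping.lookup p w) * mzv (index_of w))"

text \<open>\<open>\<phi>\<close> is a homomorphism of \<open>\<rat>\<close>-algebras from \<^const>\<open>H1\<close> with the product \<open>M\<close> to \<open>\<real>[T]\<close> that
  extends \<^const>\<open>Zeval\<close> and maps \<open>y\<close> to \<open>T\<close>.\<close>

definition is_regularization ::
    "(ncpoly \<Rightarrow> ncpoly \<Rightarrow> ncpoly) \<Rightarrow> (ncpoly \<Rightarrow> real poly) \<Rightarrow> bool" where
  "is_regularization M \<phi> \<longleftrightarrow>
     (\<forall>p\<in>H1. \<forall>q\<in>H1. \<phi> (p + q) = \<phi> p + \<phi> q) \<and>
     (\<forall>c. \<forall>p\<in>H1. \<phi> (scalar c * p) = smult (of_rat c) (\<phi> p)) \<and>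
     \<phi> 1 = 1 \<and>
     (\<forall>p\<in>H1. \<forall>q\<in>H1. \<phi> (M p q) = \<phi> p * \<phi> q) \<and>
     (\<forall>p\<in>H0. \<phi> p = [:Zeval p:]) \<and>
     \<phi> nc_y = [:0, 1:]"

text \<open>Membership in \<open>extensional H1\<close> fixes the irrelevant values outside \<^const>\<open>H1\<close>, so that the
  homomorphism is unique as a HOL function.\<close>

definition regularization :: "(ncpoly \<Rightarrow> ncpoly \<Rightarrow> ncpoly) \<Rightarrow> ncpoly \<Rightarrow> real poly" where
  "regularization M = (THE \<phi>. \<phi> \<in> extensional H1 \<and> is_regularization M \<phi>)"

definition zeta_harmonic :: "nat list \<Rightarrow> real" where
  "zeta_harmonic ls = poly (regularization harmonic (\<Prod>l\<leftarrow>ls. zgen l)) 0"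

definition zeta_shuffle :: "nat list \<Rightarrow> real" where
  "zeta_shuffle ls = poly (regularization shuffle (\<Prod>l\<leftarrow>ls. zgen l)) 0"

end

theory Submission
  imports Defs
begin

text \<open>
  Fix the weight \<open>l\<close> and depth \<open>n\<close>, and compute modulo \<open>V\<close>, the sum of \<^term>\<open>Zspace l (n - 1)\<close> and
  \<^term>\<open>Pspace l\<close>. Extend the shuffle regularized values to all words in \<open>x\<close> and \<open>y\<close>, letting the extension
  vanish on shuffle products with the letter \<open>x\<close>, and write \<open>\<phi>(e\<^sub>0; e\<^sub>1, \<dots>, e\<^sub>n)\<close> for the value at
  \<open>x\<^bsup>e\<^sub>1\<^esup> y \<cdots> x\<^bsup>e\<^sub>n\<^esup> y x\<^bsup>e\<^sub>0\<^esup>\<close>. Two relations hold modulo \<open>V\<close>.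

  \<^item> Products of regularized values lie in \<^term>\<open>Pspace l\<close>. So the antipode of the shuffle algebra, which reverses
    words, gives
    \<open>\<phi>(e\<^sub>0; e\<^sub>1, e\<^sub>2, \<dots>, e\<^sub>n) \<equiv> (-1)\<^bsup>l-1\<^esup> \<phi>(e\<^sub>1; e\<^sub>0, e\<^sub>n, \<dots>, e\<^sub>2)\<close>.
  \<^item> The harmonic product of \<open>z\<^sub>k\<close> with a word of depth \<open>n - 1\<close> is the sum of all insertions of \<open>z\<^sub>k\<close>, plus terms of
    depth \<open>n - 1\<close>. So the sum of \<open>\<phi>(e\<^sub>0; \<cdot>)\<close> over all insertions of an exponent into a list of length
    \<open>n - 1\<close> vanishes.

  Reversing all terms of an insertion sum gives another insertion sum except for one term on each side. This proves
  the rotation \<open>\<phi>(a; e\<^sub>1, \<dots>, e\<^bsub>n-1\<^esub>, c) \<equiv> \<phi>(c; a, e\<^sub>1, \<dots>, e\<^bsub>n-1\<^esub>)\<close>, and the first relation followed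
  by a rotation is the reversal congruence (\<open>reversal_congruence\<close>). Among the harmonic products
  only those with a factor of depth one are used; this is why the depth in the modulus is exactly \<open>n - 1\<close>.

  For the parity result, the antipode of the harmonic algebra, taken modulo smaller depth, gives the same
  congruence with the sign \<open>(-1)\<^bsup>n-1\<^esup>\<close>. If \<open>l + n\<close> is odd, the two signs differ.

  The second relation is about the harmonic type, so both types have to be compared
  (\<open>zsh_cong_zst\<close>). This uses analytic descriptions of the regularizations. The sums truncated at \<open>N\<close> multiply by the
  harmonic product and are asymptotic to polynomials in the harmonic number of \<open>N\<close>; the multiple
  polylogarithms multiply by the shuffle product and are asymptotic, as \<open>t\<close> tends to \<open>1\<close> from below, to
  polynomials in \<open>- ln (1 - t)\<close>. These polynomials are the values of the two regularization homomorphisms, whose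
  existence and uniqueness are established in this way for both products at once (\<open>regularized_product\<close>).
  A polylogarithm is \<open>1 - t\<close> times the generating function of the truncated sums. Abel summation therefore converts
  one expansion into the other, and the constant terms differ by products only.
\<close>

section \<open>Shuffles and the antipode\<close>

text \<open>The terms of a shuffle product are listed with their multiplicities, so that a linear functional
  \<open>f\<close> takes the value \<open>\<Sum>w\<leftarrow>shuffle_list u v. f w\<close> on it. The alphabet is arbitrary: letters
  \<open>x, y\<close> for the shuffle product, natural numbers for the leading part of the harmonic product.\<close>

fun shuffle_list :: "'a list \<Rightarrow> 'a list \<Rightarrow> 'a list list" where
  "shuffle_list [] v = [v]"
| "shuffle_list (a # u) [] = [a # u]"
| "shuffle_list (a # u) (b # v) =
     map ((#) a) (shuffle_list u (b # v)) @ map ((#) b) (shuffle_list (a # u) v)"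

lemma shuffle_list_Nil2 [simp]: "shuffle_list u [] = [u]"
  by (cases u) auto

lemma sum_list_map_Cons [simp]:
  "(\<Sum>w\<leftarrow>map ((#) a) ws. f w) = (\<Sum>w\<leftarrow>ws. f (a # w))"
  by (simp add: o_def)

lemma mset_shuffle_list: "w \<in> set (shuffle_list u v) \<Longrightarrow> mset w = mset u + mset v"
  by (induction u v arbitrary: w rule: shuffle_list.induct) auto

lemma length_shuffle_list: "w \<in> set (shuffle_list u v) \<Longrightarrow> length w = length u + length v"
  by (metis mset_shuffle_list size_mset size_union)

lemma shuffle_list_commute:
  fixes f :: "'a list \<Rightarrow> real"
  shows "(\<Sum>w\<leftarrow>shuffle_list u v. f w) = (\<Sum>w\<leftarrow>shuffle_list v u. f w)"
  by (induction u v arbitrary: f rule: shuffle_list.induct) (simp_all add: o_def)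

lemma shuffle_list_assoc:
  fixes f :: "'a list \<Rightarrow> real"
  shows "(\<Sum>w\<leftarrow>shuffle_list u v. \<Sum>z\<leftarrow>shuffle_list w q. f z)
       = (\<Sum>w\<leftarrow>shuffle_list v q. \<Sum>z\<leftarrow>shuffle_list u w. f z)"
proof (induction "length u + length v + length q" arbitrary: u v q f rule: less_induct)
  case less
  show ?case
  proof (cases "u = [] \<or> v = [] \<or> q = []")
    case True
    then show ?thesis by auto
  next
    case False
    then obtain a u' b v' c q' where [simp]: "u = a # u'" "v = b # v'" "q = c # q'"
      by (metis neq_Nil_conv)
    show ?thesis
      using less[of u' v q "\<lambda>z. f (a # z)"] less[of u v' q "\<lambda>z. f (b # z)"]
        less[of u v q' "\<lambda>z. f (c # z)"]
      by (simp add: o_def sum_list_addf algebra_simps)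
  qed
qed

text \<open>The moduli of all congruences are rational subspaces \<open>V\<close> of the reals.\<close>

locale rat_subspace =
  fixes V :: "real set"
  assumes subspace_V: "rat_real.subspace V"
begin

lemma zero_mem [simp]: "0 \<in> V"
  using rat_real.subspace_0[OF subspace_V] .

lemma add_mem: "a \<in> V \<Longrightarrow> b \<in> V \<Longrightarrow> a + b \<in> V"
  using rat_real.subspace_add[OF subspace_V] .

lemma scale_mem: "a \<in> V \<Longrightarrow> of_rat q * a \<in> V"
  using rat_real.subspace_scale[OF subspace_V] .

lemma minus_mem: "a \<in> V \<Longrightarrow> - a \<in> V"
  using rat_real.subspace_neg[OF subspace_V, of a] by simp

lemma diff_mem: "a \<in> V \<Longrightarrow> b \<in> V \<Longrightarrow> a - b \<in> V"
  using rat_real.subspace_diff[OF subspace_V] .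

lemma of_nat_mem: "a \<in> V \<Longrightarrow> of_nat k * a \<in> V"
  using scale_mem[of a "of_nat k"] by simp

lemma of_nat_cancel: "of_nat (Suc k) * a \<in> V \<Longrightarrow> a \<in> V"
  using scale_mem[of "of_nat (Suc k) * a" "inverse (of_nat (Suc k))"]
  by (simp add: of_rat_inverse del: of_nat_Suc flip: mult.assoc)

lemma sign_mem: "a \<in> V \<Longrightarrow> (-1) ^ k * a \<in> V"
  by (cases "even k") (auto simp: minus_mem)

lemma sign_mem_iff: "(-1) ^ k * a \<in> V \<longleftrightarrow> a \<in> V"
  by (cases "even k") (auto simp: minus_mem dest: minus_mem)

lemma sum_list_mem: "(\<And>x. x \<in> set xs \<Longrightarrow> f x \<in> V) \<Longrightarrow> (\<Sum>x\<leftarrow>xs. f x) \<in> V"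
  by (induction xs) (auto intro: add_mem)

text \<open>A functional that vanishes modulo \<open>V\<close> on all products of nonempty words is anti-invariant under the
  antipode \<open>w \<mapsto> (-1)\<^bsup>|w|\<^esup> rev w\<close> of the shuffle algebra. A shuffle of \<open>a p\<close> and \<open>b v\<close> starts with \<open>a\<close> or
  with \<open>b\<close>; hence moving letters one at a time from the second factor to the first, the sums of the
  shuffles with prescribed first letter change by the sign \<open>-1\<close> only.\<close>

lemma shuffle_antipode:
  assumes "\<And>u v. u \<noteq> [] \<Longrightarrow> v \<noteq> [] \<Longrightarrow> mset (u @ v) = mset w \<Longrightarrow>
              (\<Sum>z\<leftarrow>shuffle_list u v. f z) \<in> V"
    and "w \<noteq> []"
  shows "f w - (-1) ^ (length w - 1) * f (rev w) \<in> V"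
proof -
  have *: "(\<Sum>z\<leftarrow>shuffle_list p v. f (a # z)) - (-1) ^ length v * f (rev v @ a # p) \<in> V"
    if "mset (p @ a # v) = mset w" for p a v
    using that
  proof (induction v arbitrary: p a)
    case Nil
    then show ?case by (cases p) auto
  next
    case (Cons b v)
    have "(\<Sum>z\<leftarrow>shuffle_list (a # p) (b # v). f z) \<in> V"
      by (rule assms(1)) (use Cons.prems in auto)
    moreover have "(\<Sum>z\<leftarrow>shuffle_list (a # p) v. f (b # z)) - (-1) ^ length v * f (rev v @ b # a # p) \<in> V"
      by (rule Cons.IH) (use Cons.prems in auto)
    ultimately have "(\<Sum>z\<leftarrow>shuffle_list (a # p) (b # v). f z)
        - ((\<Sum>z\<leftarrow>shuffle_list (a # p) v. f (b # z)) - (-1) ^ length v * f (rev v @ b # a # p)) \<in> V"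
      by (rule diff_mem)
    then show ?case by (simp add: o_def)
  qed
  from assms(2) obtain a v where w: "w = a # v" by (cases w) auto
  show ?thesis using *[of "[]" a v] by (simp add: w)
qed

end

section \<open>Words and their exponents\<close>

abbreviation x_run :: "nat \<Rightarrow> letter list" where
  "x_run k \<equiv> replicate k Letter_x"

text \<open>An index tuple \<open>(l\<^sub>1, \<dots>, l\<^sub>n)\<close> is encoded below by its list of \<^emph>\<open>exponents\<close>
  \<open>(l\<^sub>1 - 1, \<dots>, l\<^sub>n - 1)\<close>, the numbers of letters \<open>x\<close> in front of each \<open>y\<close>. Every list of natural
  numbers then is an index tuple, and admissibility says that the first exponent is positive.\<close>

definition exp_word :: "nat list \<Rightarrow> letter list" where
  "exp_word es = concat (map (\<lambda>e. x_run e @ [Letter_y]) es)"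

lemma exp_word_Nil [simp]: "exp_word [] = []"
  and exp_word_Cons [simp]: "exp_word (e # es) = x_run e @ Letter_y # exp_word es"
  and exp_word_append [simp]: "exp_word (es @ es') = exp_word es @ exp_word es'"
  by (auto simp: exp_word_def)

lemma exp_word_eq_Nil_iff [simp]: "exp_word es = [] \<longleftrightarrow> es = []"
  by (cases es) auto

lemma length_exp_word [simp]: "length (exp_word es) = sum_list es + length es"
  by (induction es) auto

text \<open>Reversal exchanges the number of trailing letters \<open>x\<close> with the first exponent. This is why
  words that end in \<open>x\<close> have to be included.\<close>

lemma rev_exp_word: "rev (exp_word (e # es) @ x_run m) = exp_word (m # rev es) @ x_run e"
proof -
  have "rev (exp_word es) @ [Letter_y] = Letter_y # exp_word (rev es)"
  proof (induction es)
    case (Cons e es)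
    have "rev (exp_word (e # es)) @ [Letter_y] = (rev (exp_word es) @ [Letter_y]) @ x_run e @ [Letter_y]"
      by simp
    also have "\<dots> = Letter_y # exp_word (rev (e # es))"
      by (subst Cons.IH) simp
    finally show ?case .
  qed auto
  then have "rev (exp_word es) @ Letter_y # x_run e = (Letter_y # exp_word (rev es)) @ x_run e"
    by (metis append.assoc append_Cons append_Nil)
  then show ?thesis by simp
qed

lemma word_cases: obtains es m where "w = exp_word es @ x_run m"
proof (induction w arbitrary: thesis)
  case Nil
  show ?case by (rule Nil[of "[]" 0]) auto
next
  case (Cons a w)
  obtain es m where w: "w = exp_word es @ x_run m" using Cons.IH by blast
  show ?case
  proof (cases a)
    case Letter_y
    show ?thesis by (rule Cons.prems[of "0 # es" m]) (simp add: w Letter_y)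
  next
    case Letter_x
    show ?thesis
    proof (cases es)
      case Nil
      show ?thesis by (rule Cons.prems[of "[]" "Suc m"]) (simp add: w Letter_x Nil)
    next
      case (Cons e es')
      show ?thesis by (rule Cons.prems[of "Suc e # es'" m]) (simp add: w Letter_x Cons)
    qed
  qed
qed

lemma index_aux_x_run: "index_aux j (x_run e @ w) = index_aux (j + e) w"
  by (induction e arbitrary: j) auto

lemma index_of_exp_word: "index_of (exp_word es @ x_run m) = map Suc es"
proof (induction es)
  case Nil
  show ?case using index_aux_x_run[of 0 m "[]"] by (simp add: index_of_def)
qed (simp add: index_of_def index_aux_x_run)

lemma index_of_exp_word' [simp]: "index_of (exp_word es) = map Suc es"
  using index_of_exp_word[of es 0] by simp

definition exponents :: "letter list \<Rightarrow> nat list" where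
  "exponents w = map (\<lambda>k. k - 1) (index_of w)"

lemma exponents_exp_word [simp]: "exponents (exp_word es @ x_run m) = es"
  by (simp add: exponents_def index_of_exp_word o_def)

lemma exponents_exp_word' [simp]: "exponents (exp_word es) = es"
  using exponents_exp_word[of es 0] by simp

definition trailing_xs :: "letter list \<Rightarrow> nat" where
  "trailing_xs w = length (takeWhile ((=) Letter_x) (rev w))"

lemma trailing_xs_exp_word [simp]: "trailing_xs (exp_word es @ x_run m) = m"
proof -
  have "rev (exp_word es) = [] \<or> (\<exists>w. rev (exp_word es) = Letter_y # w)"
    by (cases es rule: rev_cases) auto
  then show ?thesis
    by (auto simp: trailing_xs_def takeWhile_append)
qed

section \<open>Functionals on words ending in x\<close>

text \<open>The functional \<open>f\<close> applied to the sum of all insertions of one \<open>x\<close> into a word, if \<open>f\<close> depends on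
  the exponents: an \<open>x\<close> can join the block \<open>x\<^sup>e y\<close> in \<open>e + 1\<close> ways.\<close>

fun raise_sum :: "(nat list \<Rightarrow> real) \<Rightarrow> nat list \<Rightarrow> real" where
  "raise_sum f [] = 0"
| "raise_sum f (e # es) = of_nat (Suc e) * f (Suc e # es) + raise_sum (\<lambda>v. f (e # v)) es"

lemma raise_sum_add: "raise_sum (\<lambda>v. f v + g v) es = raise_sum f es + raise_sum g es"
  by (induction es arbitrary: f g) (auto simp: algebra_simps)

text \<open>Raising exponents is a derivation for shuffles of exponent lists.\<close>

lemma raise_sum_shuffle_list:
  "(\<Sum>v\<leftarrow>shuffle_list u w. raise_sum f v)
   = raise_sum (\<lambda>u'. \<Sum>v\<leftarrow>shuffle_list u' w. f v) u + raise_sum (\<lambda>w'. \<Sum>v\<leftarrow>shuffle_list u w'. f v) w"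
proof (induction u w arbitrary: f rule: shuffle_list.induct)
  case (3 a u b v)
  then show ?case
    by (simp add: o_def sum_list_addf raise_sum_add sum_list_const_mult algebra_simps)
qed auto

lemma shuffle_list_x_x_run: "(\<Sum>w\<leftarrow>shuffle_list [Letter_x] (x_run m). f w) = of_nat (Suc m) * (f (x_run (Suc m)) :: real)"
  by (induction m arbitrary: f) (auto simp: o_def algebra_simps)

lemma shuffle_list_x_block:
  fixes f :: "letter list \<Rightarrow> real"
  shows "(\<Sum>w\<leftarrow>shuffle_list [Letter_x] (x_run e @ Letter_y # u). f w)
    = of_nat (Suc e) * f (x_run (Suc e) @ Letter_y # u) + (\<Sum>w\<leftarrow>shuffle_list [Letter_x] u. f (x_run e @ Letter_y # w))"
  by (induction e arbitrary: f) (auto simp: o_def algebra_simps)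

lemma shuffle_list_x_exp_word:
  "(\<Sum>w\<leftarrow>shuffle_list [Letter_x] (exp_word es @ x_run m). f w)
    = raise_sum (\<lambda>v. f (exp_word v @ x_run m)) es + of_nat (Suc m) * f (exp_word es @ x_run (Suc m))"
proof (induction es arbitrary: f)
  case Nil
  show ?case using shuffle_list_x_x_run[of f m] by simp
next
  case (Cons e es)
  show ?case by (simp add: shuffle_list_x_block Cons.IH del: of_nat_Suc)
qed

text \<open>The extension of a functional \<open>\<psi>\<close> from words ending in \<open>y\<close> to words \<open>w x\<^sup>m\<close>, determined by the
  requirement that it kills the shuffle products of \<open>x\<close> with all words. Since
  \<open>x\<close> shuffled with \<open>w x\<^sup>m\<close> contains \<open>w x\<^bsup>m+1\<^esup>\<close> with multiplicity \<open>m + 1\<close>, this is a recursion on \<open>m\<close>.\<close>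

fun x_reg :: "(nat list \<Rightarrow> real) \<Rightarrow> nat \<Rightarrow> nat list \<Rightarrow> real" where
  "x_reg \<psi> 0 es = \<psi> es"
| "x_reg \<psi> (Suc m) es = - raise_sum (x_reg \<psi> m) es / of_nat (Suc m)"

definition word_ext :: "(nat list \<Rightarrow> real) \<Rightarrow> letter list \<Rightarrow> real" where
  "word_ext \<psi> w = x_reg \<psi> (trailing_xs w) (exponents w)"

lemma word_ext_exp_word [simp]: "word_ext \<psi> (exp_word es @ x_run m) = x_reg \<psi> m es"
  by (simp add: word_ext_def)

lemma word_ext_exp_word' [simp]: "word_ext \<psi> (exp_word es) = \<psi> es"
  using word_ext_exp_word[of \<psi> es 0] by simp

lemma word_ext_shuffle_x: "(\<Sum>w\<leftarrow>shuffle_list [Letter_x] w. word_ext \<psi> w) = 0"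
proof -
  obtain es m where w: "w = exp_word es @ x_run m" by (rule word_cases)
  show ?thesis
    unfolding w shuffle_list_x_exp_word word_ext_exp_word by (simp del: of_nat_Suc)
qed

context rat_subspace
begin

lemma raise_sum_mem:
  assumes "\<And>v. length v = length es \<Longrightarrow> sum_list v = Suc (sum_list es) \<Longrightarrow> f v \<in> V"
  shows "raise_sum f es \<in> V"
  using assms
proof (induction es arbitrary: f)
  case (Cons e es)
  have "raise_sum (\<lambda>v. f (e # v)) es \<in> V"
    by (rule Cons.IH) (rule Cons.prems, auto)
  moreover have "f (Suc e # es) \<in> V" by (rule Cons.prems) auto
  ultimately show ?case by (auto intro!: add_mem of_nat_mem simp del: of_nat_Suc)
qed auto

text \<open>The extension stays multiplicative modulo \<open>V\<close> (that is, it sends products of nonempty words to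
  \<open>V\<close>) on words with trailing letters \<open>x\<close>. In \<open>w x\<^bsup>a+1\<^esup>\<close> a trailing \<open>x\<close> is written as a shuffle
  factor \<open>x\<close> up to words with fewer trailing letters; by associativity that factor can be pulled out of the
  whole product, where the extension vanishes.\<close>

lemma word_ext_shuffle_mem:
  assumes H1: "\<And>es es'. es \<noteq> [] \<Longrightarrow> es' \<noteq> [] \<Longrightarrow> length (exp_word es) + length (exp_word es') = N \<Longrightarrow>
      (\<Sum>w\<leftarrow>shuffle_list (exp_word es) (exp_word es'). word_ext \<psi> w) \<in> V"
    and "u \<noteq> []" "v \<noteq> []" "length u + length v = N"
  shows "(\<Sum>w\<leftarrow>shuffle_list u v. word_ext \<psi> w) \<in> V"
proof -
  let ?f = "word_ext \<psi>"
  have *: "(\<Sum>w\<leftarrow>shuffle_list (exp_word es @ x_run a) (exp_word es' @ x_run b). ?f w) \<in> V"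
    if "a + b = s" "exp_word es @ x_run a \<noteq> []" "exp_word es' @ x_run b \<noteq> []"
      "length (exp_word es @ x_run a) + length (exp_word es' @ x_run b) = N" for a b s es es'
    using that
  proof (induction s arbitrary: a b es es')
    case 0
    then show ?case using H1[of es es'] by auto
  next
    case (Suc s)
    have step: "(\<Sum>w\<leftarrow>shuffle_list (exp_word es @ x_run (Suc a)) (exp_word es' @ x_run b). ?f w) \<in> V"
      if "a + b = s" "exp_word es' @ x_run b \<noteq> []"
      "length (exp_word es @ x_run (Suc a)) + length (exp_word es' @ x_run b) = N" for a b es es'
    proof -
      define g where "g = (\<lambda>w. \<Sum>z\<leftarrow>shuffle_list w (exp_word es' @ x_run b). ?f z)"
      have "(\<Sum>w\<leftarrow>shuffle_list [Letter_x] (exp_word es @ x_run a). g w) = 0"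
        unfolding g_def shuffle_list_assoc word_ext_shuffle_x by simp
      then have eq: "of_nat (Suc a) * g (exp_word es @ x_run (Suc a)) = - raise_sum (\<lambda>v. g (exp_word v @ x_run a)) es"
        unfolding shuffle_list_x_exp_word by simp
      have "raise_sum (\<lambda>v. g (exp_word v @ x_run a)) es \<in> V"
      proof (cases "es = []")
        case False
        show ?thesis
        proof (rule raise_sum_mem)
          fix v assume v: "length v = length es" "sum_list v = Suc (sum_list es)"
          show "g (exp_word v @ x_run a) \<in> V" unfolding g_def
            by (rule Suc.IH) (use that False v in auto)
        qed
      qed auto
      with eq have "of_nat (Suc a) * g (exp_word es @ x_run (Suc a)) \<in> V" using minus_mem by simp
      then show ?thesis unfolding g_def by (rule of_nat_cancel)
    qed
    show ?case
    proof (cases a)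
      case (Suc a')
      then show ?thesis using step[of a' b es' es] Suc.prems by auto
    next
      case 0
      with Suc.prems have "b = Suc s" by simp
      with 0 show ?thesis using step[of s 0 es es'] Suc.prems
        by (subst shuffle_list_commute) auto
    qed
  qed
  obtain es a es' b where "u = exp_word es @ x_run a" "v = exp_word es' @ x_run b"
    by (meson word_cases)
  with *[OF refl] assms(2-) show ?thesis by simp
qed

end

section \<open>The reversal congruence for a functional\<close>

lemma shuffle_list_singleton_snoc:
  fixes f :: "'a list \<Rightarrow> real"
  shows "(\<Sum>v\<leftarrow>shuffle_list [a] (c @ [d]). f v) = (\<Sum>v\<leftarrow>shuffle_list [a] c. f (v @ [d])) + f (c @ [d, a])"
  by (induction c arbitrary: f) (auto simp: o_def)

lemma shuffle_list_singleton_rev: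
  fixes f :: "'a list \<Rightarrow> real"
  shows "(\<Sum>v\<leftarrow>shuffle_list [a] (rev c). f v) = (\<Sum>v\<leftarrow>shuffle_list [a] c. f (rev v))"
  by (induction c arbitrary: f) (auto simp: o_def shuffle_list_singleton_snoc)

text \<open>The heart of the matter. Write \<open>\<phi>(m; e\<^sub>1, \<dots>, e\<^sub>n)\<close> for the value at
  \<open>x\<^bsup>e\<^sub>1\<^esup> y \<cdots> x\<^bsup>e\<^sub>n\<^esup> y x\<^sup>m\<close>. The antipode gives
  \<open>\<phi>(m; e, es) \<equiv> (-1)\<^bsup>N-1\<^esup> \<phi>(e; m, rev es)\<close>. The second hypothesis says that the sum of
  \<open>\<phi>(0; \<cdot>)\<close> over all insertions of an exponent \<open>a\<close> into a list vanishes, and this carries over to all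
  \<open>m\<close>, because \<open>\<phi>(m + 1; \<cdot>)\<close> arises from \<open>\<phi>(m; \<cdot>)\<close> by a derivation. Applying the antipode to every term
  of the insertion sum for \<open>\<phi>(m; c, \<dots>)\<close>, all terms but one become terms of an insertion sum for
  \<open>\<phi>(c; m, \<dots>)\<close>, which also lacks just one term. The two missing terms therefore agree:
  \<open>\<phi>(a; es, c) \<equiv> \<phi>(c; a, es)\<close>. The antipode followed by this rotation is the reversal.\<close>

lemma (in rat_subspace) reversal_congruence:
  assumes shuffle: "\<And>es es'. es \<noteq> [] \<Longrightarrow> es' \<noteq> [] \<Longrightarrow> length (exp_word es) + length (exp_word es') = N \<Longrightarrow>
      (\<Sum>w\<leftarrow>shuffle_list (exp_word es) (exp_word es'). word_ext \<psi> w) \<in> V"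
    and stuffle: "\<And>a cs. Suc (length cs) = n \<Longrightarrow> a + sum_list cs + n = N \<Longrightarrow>
      (\<Sum>v\<leftarrow>shuffle_list [a] cs. \<psi> v) \<in> V"
    and es: "length es = n" "sum_list es + n = N" "es \<noteq> []"
  shows "\<psi> es - (-1) ^ (N - 1) * \<psi> (rev es) \<in> V"
proof -
  let ?f = "word_ext \<psi>" and ?s = "(-1) ^ (N - 1) :: real"
  define \<phi> where "\<phi> m es = ?f (exp_word es @ x_run m)" for m es
  have sh: "(\<Sum>w\<leftarrow>shuffle_list u v. ?f w) \<in> V"
    if "u \<noteq> []" "v \<noteq> []" "length u + length v = N" for u v
    by (rule word_ext_shuffle_mem[OF shuffle that])
  have insert: "(\<Sum>v\<leftarrow>shuffle_list [a] cs. \<phi> m v) \<in> V"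
    if "Suc (length cs) = n" "m + a + sum_list cs + n = N" for m a cs
    using that
  proof (induction m arbitrary: a cs)
    case 0
    then show ?case using stuffle[of cs a] by (simp add: \<phi>_def)
  next
    case (Suc m)
    have raise: "of_nat (Suc m) * \<phi> (Suc m) v = - raise_sum (\<phi> m) v" for v
      using word_ext_shuffle_x[of \<psi> "exp_word v @ x_run m"]
      unfolding shuffle_list_x_exp_word \<phi>_def by linarith
    have "of_nat (Suc m) * (\<Sum>v\<leftarrow>shuffle_list [a] cs. \<phi> (Suc m) v)
        = - (\<Sum>v\<leftarrow>shuffle_list [a] cs. raise_sum (\<phi> m) v)"
      unfolding sum_list_const_mult[symmetric] raise by (simp add: uminus_sum_list_map o_def)
    moreover have "(\<Sum>v\<leftarrow>shuffle_list [a] cs. raise_sum (\<phi> m) v) \<in> V"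
      unfolding raise_sum_shuffle_list
    proof (rule add_mem; rule raise_sum_mem)
      fix v :: "nat list" assume "length v = length [a]" "sum_list v = Suc (sum_list [a])"
      then have "v = [Suc a]" by (cases v) auto
      then show "(\<Sum>v\<leftarrow>shuffle_list v cs. \<phi> m v) \<in> V"
        using Suc.IH[of cs "Suc a"] Suc.prems by simp
    next
      fix v assume "length v = length cs" "sum_list v = Suc (sum_list cs)"
      then show "(\<Sum>v\<leftarrow>shuffle_list [a] v. \<phi> m v) \<in> V"
        using Suc.IH[of v a] Suc.prems by simp
    qed
    ultimately show ?case using minus_mem of_nat_cancel by metis
  qed
  \<comment> \<open>the antipode of the shuffle algebra\<close>
  have antipode: "\<phi> m (e # es) - ?s * \<phi> e (m # rev es) \<in> V"
    if "Suc (length es) = n" "m + e + sum_list es + n = N" for m e es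
  proof -
    have "?f (exp_word (e # es) @ x_run m) - (-1) ^ (length (exp_word (e # es) @ x_run m) - 1) * ?f (rev (exp_word (e # es) @ x_run m)) \<in> V"
    proof (rule shuffle_antipode)
      fix u v assume "mset (u @ v) = mset (exp_word (e # es) @ x_run m)"
      then have "length (u @ v) = length (exp_word (e # es) @ x_run m)" by (rule mset_eq_length)
      moreover assume "u \<noteq> []" "v \<noteq> []"
      ultimately show "(\<Sum>z\<leftarrow>shuffle_list u v. ?f z) \<in> V" using that by (intro sh) auto
    qed auto
    moreover have "length (exp_word (e # es) @ x_run m) = N" using that by simp
    ultimately show ?thesis by (simp only: \<phi>_def rev_exp_word)
  qed
  \<comment> \<open>the insertion in front is the unmatched term: its reversal is marked by \<open>a\<close>, the others by \<open>c\<close>\<close>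
  have rotate: "\<phi> a (m # ds @ [c]) - \<phi> c (a # m # ds) \<in> V"
    if "length ds + 2 = n" "a + m + sum_list ds + c + n = N" for a m c ds
  proof -
    let ?R = "\<Sum>v\<leftarrow>shuffle_list [a] (rev ds). \<phi> m (c # v)"
    let ?S = "\<Sum>v\<leftarrow>shuffle_list [a] ds. \<phi> c (m # v)"
    have "(\<Sum>v\<leftarrow>shuffle_list [a] (c # rev ds). \<phi> m v) \<in> V"
      by (rule insert) (use that in auto)
    then have 1: "\<phi> m (a # c # rev ds) + ?R \<in> V" by (simp add: o_def)
    have "(\<Sum>v\<leftarrow>shuffle_list [a] (m # ds). \<phi> c v) \<in> V"
      by (rule insert) (use that in auto)
    then have 2: "\<phi> c (a # m # ds) + ?S \<in> V" by (simp add: o_def)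
    have 3: "\<phi> m (a # c # rev ds) - ?s * \<phi> a (m # ds @ [c]) \<in> V"
      using antipode[of "c # rev ds" m a] that by simp
    have "?R - ?s * ?S = (\<Sum>v\<leftarrow>shuffle_list [a] ds. \<phi> m (c # rev v) - ?s * \<phi> c (m # v))"
      by (simp add: shuffle_list_singleton_rev sum_list_subtractf sum_list_const_mult)
    also have "\<dots> \<in> V"
    proof (rule sum_list_mem)
      fix v assume "v \<in> set (shuffle_list [a] ds)"
      then have "mset v = mset (a # ds)" by (auto dest: mset_shuffle_list)
      then have "length v = Suc (length ds)" "sum_list v = a + sum_list ds"
        by (metis length_Cons mset_eq_length, metis sum_mset_sum_list sum_list.Cons)
      then show "\<phi> m (c # rev v) - ?s * \<phi> c (m # v) \<in> V"
        using antipode[of "rev v" m c] that by simp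
    qed
    finally have 4: "?R - ?s * ?S \<in> V" .
    have "?s * (\<phi> a (m # ds @ [c]) - \<phi> c (a # m # ds))
       = (\<phi> m (a # c # rev ds) + ?R) - ?s * (\<phi> c (a # m # ds) + ?S)
         - (\<phi> m (a # c # rev ds) - ?s * \<phi> a (m # ds @ [c])) - (?R - ?s * ?S)"
      by (simp add: algebra_simps)
    also have "\<dots> \<in> V" by (intro diff_mem sign_mem 1 2 3 4)
    finally show ?thesis by (simp add: sign_mem_iff)
  qed
  obtain e ds where [simp]: "es = e # ds" using es by (cases es) auto
  show ?thesis
  proof (cases "rev ds")
    case Nil
    then have "\<psi> es \<in> V" using stuffle[of "[]" e] es by simp
    then show ?thesis using Nil by (auto intro!: diff_mem sign_mem)
  next
    case (Cons m ds')
    have "sum_list ds = sum_list (rev ds)" by simp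
    with Cons have sum: "sum_list ds = m + sum_list ds'" by simp
    have len: "length ds = Suc (length ds')" using Cons by (metis length_rev length_Cons)
    have "\<phi> 0 (m # ds' @ [e]) - \<phi> e (0 # m # ds') \<in> V"
      by (rule rotate) (use es sum len in auto)
    moreover have "\<phi> 0 (e # ds) - ?s * \<phi> e (0 # rev ds) \<in> V"
      by (rule antipode) (use es in auto)
    ultimately have "(\<phi> 0 (e # ds) - ?s * \<phi> e (0 # rev ds)) - ?s * (\<phi> 0 (m # ds' @ [e]) - \<phi> e (0 # m # ds')) \<in> V"
      by (metis diff_mem sign_mem)
    moreover have "\<phi> 0 v = \<psi> v" for v by (simp add: \<phi>_def)
    ultimately show ?thesis using Cons by (simp add: algebra_simps)
  qed
qed

section \<open>Non-commutative polynomials\<close>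

lemma word_Nil: "word [] = 1"
  by (simp add: word_def zero_list_def[symmetric])

lemma word_append: "word (u @ v) = word u * word v"
  by (simp add: word_def mult_single plus_list_def)

lemma scalar_1 [simp]: "scalar 1 = 1"
  by (simp add: scalar_def zero_list_def[symmetric])

lemma lookup_scalar_mult [simp]:
  "Poly_Mapping.lookup (scalar c * p) w = c * Poly_Mapping.lookup p w"
proof -
  have "scalar c * p = Poly_Mapping.map ((*) c) p"
    by (simp add: mult_map_scale_conv_mult scalar_def zero_list_def)
  then show ?thesis by (simp add: Poly_Mapping.map.rep_eq when_def)
qed

lemma keys_scalar_mult: "Poly_Mapping.keys (scalar c * p) \<subseteq> Poly_Mapping.keys p"
  by (auto simp: in_keys_iff)

lemma ncpoly_expand:
  "p = (\<Sum>w\<in>Poly_Mapping.keys p. scalar (Poly_Mapping.lookup p w) * word w)"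
proof (rule poly_mapping_eqI)
  fix k
  have "(\<Sum>w\<in>Poly_Mapping.keys p. Poly_Mapping.lookup p w * (1 when w = k))
      = Poly_Mapping.lookup p k"
    by (cases "k \<in> Poly_Mapping.keys p")
       (auto simp: when_def in_keys_iff if_distrib sum.delta cong: if_cong)
  then show "Poly_Mapping.lookup p k
      = Poly_Mapping.lookup (\<Sum>w\<in>Poly_Mapping.keys p. scalar (Poly_Mapping.lookup p w) * word w) k"
    by (simp add: lookup_sum word_def lookup_single)
qed

lemma zgen_Suc: "zgen (Suc e) = word (x_run e @ [Letter_y])"
proof -
  have "nc_x ^ e = word (x_run e)"
    by (induction e) (auto simp: word_Nil nc_x_def simp flip: word_append)
  then show ?thesis by (simp add: zgen_def word_append nc_y_def)
qed

lemma prod_list_zgen: "(\<Prod>l\<leftarrow>map Suc es. zgen l) = word (exp_word es)"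
proof (induction es)
  case (Cons e es)
  have "x_run e @ Letter_y # exp_word es = (x_run e @ [Letter_y]) @ exp_word es" by simp
  then show ?case
    using Cons by (simp add: zgen_Suc o_def flip: word_append)
qed (simp add: word_Nil)

lemma keys_word [simp]: "Poly_Mapping.keys (word w) = {w}"
  by (simp add: word_def)

lemma lookup_word: "Poly_Mapping.lookup (word w) v = (if v = w then 1 else 0)"
  by (auto simp: word_def lookup_single)

lemma snoc_y_in_range: "w @ [Letter_y] \<in> range exp_word"
proof -
  obtain es m where "w = exp_word es @ x_run m" by (rule word_cases)
  then have "w @ [Letter_y] = exp_word (es @ [m])" by simp
  then show ?thesis by blast
qed

lemma keys_mult_nc_y: "w \<in> Poly_Mapping.keys (p * nc_y) \<Longrightarrow> \<exists>u\<in>Poly_Mapping.keys p. w = u @ [Letter_y]"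
  using keys_mult[of p nc_y] by (auto simp: nc_y_def plus_list_def)

lemma keys_nc_x_mult: "w \<in> Poly_Mapping.keys (nc_x * p) \<Longrightarrow> \<exists>u\<in>Poly_Mapping.keys p. w = Letter_x # u"
  using keys_mult[of nc_x p] by (auto simp: nc_x_def plus_list_def)

lemma keys_scalar_add: "w \<in> Poly_Mapping.keys (scalar c + q) \<Longrightarrow> w = [] \<or> w \<in> Poly_Mapping.keys q"
  by (auto simp: in_keys_iff lookup_add scalar_def lookup_single when_def split: if_splits)

lemma keys_H1: "p \<in> H1 \<Longrightarrow> Poly_Mapping.keys p \<subseteq> range exp_word"
proof
  fix w assume "p \<in> H1" "w \<in> Poly_Mapping.keys p"
  then obtain c q where "w \<in> Poly_Mapping.keys (scalar c + q * nc_y)" by (auto simp: H1_def)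
  then consider "w = []" | "w \<in> Poly_Mapping.keys (q * nc_y)"
    by (auto dest: keys_scalar_add)
  then show "w \<in> range exp_word"
  proof cases
    case 1
    then have "w = exp_word []" by simp
    then show ?thesis by blast
  qed (use keys_mult_nc_y snoc_y_in_range in blast)
qed

lemma H1_add: "p \<in> H1 \<Longrightarrow> q \<in> H1 \<Longrightarrow> p + q \<in> H1"
proof -
  assume "p \<in> H1" "q \<in> H1"
  then obtain c p' d q' where "p = scalar c + p' * nc_y" "q = scalar d + q' * nc_y"
    by (auto simp: H1_def)
  then have "p + q = scalar (c + d) + (p' + q') * nc_y"
    by (simp add: scalar_def single_add algebra_simps)
  then show ?thesis by (auto simp: H1_def)
qed

lemma H1_scale: "p \<in> H1 \<Longrightarrow> scalar c * p \<in> H1"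
proof -
  assume "p \<in> H1"
  then obtain d q where "p = scalar d + q * nc_y" by (auto simp: H1_def)
  then have "scalar c * p = scalar (c * d) + (scalar c * q) * nc_y"
    by (simp add: scalar_def mult_single plus_list_def algebra_simps)
  then show ?thesis by (auto simp: H1_def)
qed

lemma H1_0: "0 \<in> H1"
proof -
  have "0 = scalar 0 + 0 * nc_y" by (simp add: scalar_def)
  then show ?thesis unfolding H1_def by blast
qed

lemma word_exp_word_H1: "word (exp_word es) \<in> H1"
proof (cases es rule: rev_cases)
  case Nil
  then have "word (exp_word es) = scalar 1 + 0 * nc_y" by (simp add: word_Nil)
  then show ?thesis unfolding H1_def by blast
next
  case (snoc fs e)
  then have "word (exp_word es) = scalar 0 + word (exp_word fs @ x_run e) * nc_y"
    by (simp add: nc_y_def scalar_def flip: word_append)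
  then show ?thesis unfolding H1_def by blast
qed

lemma H1_sum: "(\<And>i. i \<in> A \<Longrightarrow> f i \<in> H1) \<Longrightarrow> sum f A \<in> H1"
  by (induction A rule: infinite_finite_induct) (auto simp: H1_0 H1_add)

lemma H1_sum_list: "(\<And>i. i \<in> set A \<Longrightarrow> f i \<in> H1) \<Longrightarrow> (\<Sum>i\<leftarrow>A. f i) \<in> H1"
  by (induction A) (auto simp: H1_0 H1_add)

text \<open>For \<open>H0\<close> only the shape of the words is needed: the empty word or a word whose first exponent
  is positive.\<close>

lemma keys_H0:
  assumes "p \<in> H0" "w \<in> Poly_Mapping.keys p"
  obtains "w = []" | e es where "w = exp_word (Suc e # es)"
proof -
  from assms obtain c q where "w \<in> Poly_Mapping.keys (scalar c + nc_x * q * nc_y)"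
    by (auto simp: H0_def)
  then consider "w = []" | "w \<in> Poly_Mapping.keys (nc_x * q * nc_y)"
    by (auto dest: keys_scalar_add)
  then show ?thesis
  proof cases
    case 2
    then obtain v where "v \<in> Poly_Mapping.keys (nc_x * q)" "w = v @ [Letter_y]"
      by (auto dest: keys_mult_nc_y)
    then obtain u where "w = Letter_x # u @ [Letter_y]"
      by (auto dest: keys_nc_x_mult)
    moreover obtain fs where fs: "u @ [Letter_y] = exp_word fs" using snoc_y_in_range by blast
    moreover have "fs \<noteq> []" using fs by auto
    ultimately show ?thesis using that(2) by (cases fs) auto
  qed (use that in blast)
qed

lemma H0_subset_H1: "H0 \<subseteq> H1"
  by (auto simp: H0_def H1_def)

lemma word_in_H0: "word (exp_word (Suc e # es)) \<in> H0"
proof -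
  have "exp_word (Suc e # es) \<in> range (\<lambda>u. Letter_x # u @ [Letter_y])"
  proof (cases es rule: rev_cases)
    case Nil
    then show ?thesis by auto
  next
    case (snoc fs f)
    then have "exp_word (Suc e # es) = Letter_x # (x_run e @ Letter_y # exp_word fs @ x_run f) @ [Letter_y]"
      by simp
    then show ?thesis by blast
  qed
  then obtain u where "exp_word (Suc e # es) = [Letter_x] @ u @ [Letter_y]" by auto
  then have "word (exp_word (Suc e # es)) = scalar 0 + nc_x * word u * nc_y"
    by (simp add: nc_x_def nc_y_def scalar_def mult.assoc del: exp_word_Cons flip: word_append)
  then show ?thesis unfolding H0_def by blast
qed

text \<open>The rational-linear extension of a function on index tuples to non-commutative polynomials; both
  regularization homomorphisms have this form.\<close>

definition linear_ext :: "(nat list \<Rightarrow> real poly) \<Rightarrow> ncpoly \<Rightarrow> real poly" where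
  "linear_ext R p = (\<Sum>w\<in>Poly_Mapping.keys p. smult (of_rat (Poly_Mapping.lookup p w)) (R (exponents w)))"

lemma linear_ext_superset:
  assumes "finite A" "Poly_Mapping.keys p \<subseteq> A"
  shows "linear_ext R p = (\<Sum>w\<in>A. smult (of_rat (Poly_Mapping.lookup p w)) (R (exponents w)))"
  unfolding linear_ext_def using assms
  by (intro sum.mono_neutral_left) (auto simp: in_keys_iff)

lemma linear_ext_add: "linear_ext R (p + q) = linear_ext R p + linear_ext R q"
proof -
  let ?A = "Poly_Mapping.keys p \<union> Poly_Mapping.keys q"
  have "linear_ext R (p + q) = (\<Sum>w\<in>?A. smult (of_rat (Poly_Mapping.lookup (p + q) w)) (R (exponents w)))"
    by (rule linear_ext_superset) (auto simp: in_keys_iff lookup_add)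
  also have "\<dots> = linear_ext R p + linear_ext R q"
    by (subst (1 2) linear_ext_superset[of ?A])
       (auto simp: lookup_add of_rat_add smult_add_left sum.distrib)
  finally show ?thesis .
qed

lemma linear_ext_0 [simp]: "linear_ext R 0 = 0"
  by (simp add: linear_ext_def)

lemma linear_ext_scale: "linear_ext R (scalar c * p) = smult (of_rat c) (linear_ext R p)"
proof -
  have "linear_ext R (scalar c * p) = (\<Sum>w\<in>Poly_Mapping.keys p. smult (of_rat (c * Poly_Mapping.lookup p w)) (R (exponents w)))"
    by (subst linear_ext_superset[OF _ keys_scalar_mult]) auto
  also have "\<dots> = smult (of_rat c) (linear_ext R p)"
    unfolding linear_ext_def by (induction rule: infinite_finite_induct) (auto simp: of_rat_mult smult_add_right)
  finally show ?thesis .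
qed

lemma linear_ext_word [simp]: "linear_ext R (word w) = R (exponents w)"
  by (simp add: linear_ext_def lookup_word)

lemma linear_ext_sum: "linear_ext R (sum f A) = (\<Sum>i\<in>A. linear_ext R (f i))"
  by (induction A rule: infinite_finite_induct) (auto simp: linear_ext_add)

lemma linear_ext_sum_list: "linear_ext R (\<Sum>i\<leftarrow>A. f i) = (\<Sum>i\<leftarrow>A. linear_ext R (f i))"
  by (induction A) (auto simp: linear_ext_add)

text \<open>The number of leading letters \<open>y\<close>, the measure of all inductions that express arbitrary words
  through \<open>y\<close> and words in \<open>H0\<close>.\<close>

fun leading_zeros :: "nat list \<Rightarrow> nat" where
  "leading_zeros (0 # es) = Suc (leading_zeros es)"
| "leading_zeros _ = 0"

lemma leading_zeros_eq_0: "leading_zeros es = 0 \<longleftrightarrow> es = [] \<or> hd es \<noteq> 0"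
  by (cases es rule: leading_zeros.cases) auto

lemma sum_list_partition:
  fixes f :: "'a \<Rightarrow> 'b :: comm_monoid_add"
  shows "(\<Sum>x\<leftarrow>ws. f x) = (\<Sum>x\<leftarrow>filter P ws. f x) + (\<Sum>x\<leftarrow>filter (\<lambda>x. \<not> P x) ws. f x)"
  by (induction ws) (auto simp: algebra_simps)

section \<open>Asymptotic polynomials\<close>

text \<open>The function \<open>f\<close> agrees along \<open>F\<close> with the polynomial \<open>p\<close> in the divergent quantity \<open>L\<close>, up to an
  error that is smaller than every power of \<open>1 / L\<close>. An error that merely tends to \<open>0\<close> would not
  survive multiplication.\<close>

definition asymp_poly :: "'b filter \<Rightarrow> ('b \<Rightarrow> real) \<Rightarrow> ('b \<Rightarrow> real) \<Rightarrow> real poly \<Rightarrow> bool" where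
  "asymp_poly F L f p \<longleftrightarrow> (\<forall>s. ((\<lambda>t. (f t - poly p (L t)) * poly s (L t)) \<longlongrightarrow> 0) F)"

lemma asymp_polyD: "asymp_poly F L f p \<Longrightarrow> ((\<lambda>t. (f t - poly p (L t)) * poly s (L t)) \<longlongrightarrow> 0) F"
  by (simp add: asymp_poly_def)

lemma asymp_poly_tendsto: "asymp_poly F L f p \<Longrightarrow> ((\<lambda>t. f t - poly p (L t)) \<longlongrightarrow> 0) F"
  using asymp_polyD[of F L f p 1] by simp

lemma asymp_polyI:
  assumes "\<And>j. ((\<lambda>t. (f t - poly p (L t)) * L t ^ j) \<longlongrightarrow> 0) F"
  shows "asymp_poly F L f p"
  unfolding asymp_poly_def
proof
  fix s
  have "((\<lambda>t. \<Sum>j\<le>degree s. coeff s j * ((f t - poly p (L t)) * L t ^ j)) \<longlongrightarrow> (\<Sum>j\<le>degree s. coeff s j * 0)) F"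
    by (intro tendsto_intros assms)
  then show "((\<lambda>t. (f t - poly p (L t)) * poly s (L t)) \<longlongrightarrow> 0) F"
    by (simp add: poly_altdef[of s] sum_distrib_left mult.left_commute)
qed

lemma asymp_poly_exact: "(\<And>t. f t = poly p (L t)) \<Longrightarrow> asymp_poly F L f p"
  by (simp add: asymp_poly_def)

lemma asymp_poly_cong:
  assumes "asymp_poly F L f p" "\<forall>\<^sub>F t in F. f t = g t"
  shows "asymp_poly F L g p"
  unfolding asymp_poly_def
proof
  fix s
  show "((\<lambda>t. (g t - poly p (L t)) * poly s (L t)) \<longlongrightarrow> 0) F"
    by (rule Lim_transform_eventually[OF asymp_polyD[OF assms(1), of s]])
       (use assms(2) in eventually_elim, simp)
qed

lemma asymp_poly_add:
  assumes "asymp_poly F L f p" "asymp_poly F L g q"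
  shows "asymp_poly F L (\<lambda>t. f t + g t) (p + q)"
  unfolding asymp_poly_def
proof
  fix s
  show "((\<lambda>t. (f t + g t - poly (p + q) (L t)) * poly s (L t)) \<longlongrightarrow> 0) F"
    using tendsto_add[OF asymp_polyD[OF assms(1), of s] asymp_polyD[OF assms(2), of s]]
    by (simp add: algebra_simps)
qed

lemma asymp_poly_cmult:
  assumes "asymp_poly F L f p"
  shows "asymp_poly F L (\<lambda>t. c * f t) (smult c p)"
  unfolding asymp_poly_def
proof
  fix s
  show "((\<lambda>t. (c * f t - poly (smult c p) (L t)) * poly s (L t)) \<longlongrightarrow> 0) F"
    using tendsto_mult_left[OF asymp_polyD[OF assms(1), of s], of c]
    by (simp add: algebra_simps)
qed

lemma asymp_poly_sum_list:
  assumes "\<And>x. x \<in> set A \<Longrightarrow> asymp_poly F L (f x) (p x)"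
  shows "asymp_poly F L (\<lambda>t. \<Sum>x\<leftarrow>A. f x t) (\<Sum>x\<leftarrow>A. p x)"
  using assms
proof (induction A)
  case Nil
  then show ?case by (simp add: asymp_poly_exact)
next
  case (Cons x A)
  then show ?case using asymp_poly_add[of F L "f x" "p x"] by simp
qed

lemma asymp_poly_sum:
  assumes "\<And>x. x \<in> A \<Longrightarrow> asymp_poly F L (f x) (p x)"
  shows "asymp_poly F L (\<lambda>t. \<Sum>x\<in>A. f x t) (\<Sum>x\<in>A. p x)"
  using assms
proof (induction A rule: infinite_finite_induct)
  case (insert x A)
  then show ?case using asymp_poly_add[of F L "f x" "p x"] by simp
qed (simp_all add: asymp_poly_exact)

lemma asymp_poly_mult:
  assumes "asymp_poly F L f p" "asymp_poly F L g q"
  shows "asymp_poly F L (\<lambda>t. f t * g t) (p * q)"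
  unfolding asymp_poly_def
proof
  fix s
  have "((\<lambda>t. ((f t - poly p (L t)) * poly s (L t)) * ((g t - poly q (L t)) * poly 1 (L t))
     + (f t - poly p (L t)) * poly (q * s) (L t) + (g t - poly q (L t)) * poly (p * s) (L t))
     \<longlongrightarrow> 0 * 0 + 0 + 0) F"
    by (intro tendsto_add tendsto_mult asymp_polyD assms)
  then show "((\<lambda>t. (f t * g t - poly (p * q) (L t)) * poly s (L t)) \<longlongrightarrow> 0) F"
    by (simp add: algebra_simps)
qed

text \<open>Asymptotic polynomials are unique because a nonzero polynomial does not tend to \<open>0\<close> at infinity.\<close>

lemma poly_tendsto_0_imp_0:
  fixes p :: "real poly"
  assumes "((\<lambda>t. poly p (L t)) \<longlongrightarrow> 0) F" "filterlim L at_top F" "F \<noteq> bot"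
  shows "p = 0"
proof -
  have *: False if q: "((\<lambda>t. poly q (L t)) \<longlongrightarrow> 0) F" "lead_coeff q > 0" for q :: "real poly"
  proof -
    obtain n where n: "\<And>x. x \<ge> n \<Longrightarrow> poly q x \<ge> lead_coeff q"
      using poly_pinfty_gt_lc[OF q(2)] by blast
    have "\<forall>\<^sub>F t in F. L t \<ge> n" using assms(2) by (simp add: filterlim_at_top)
    then have "\<forall>\<^sub>F t in F. lead_coeff q \<le> poly q (L t)" by eventually_elim (rule n)
    then have "lead_coeff q \<le> 0" using tendsto_lowerbound[OF q(1) _ assms(3)] by blast
    with q(2) show False by simp
  qed
  show ?thesis
  proof (rule ccontr)
    assume "p \<noteq> 0"
    then consider "lead_coeff p > 0" | "lead_coeff (- p) > 0"
      by (metis leading_coeff_0_iff lead_coeff_minus linorder_neqE_linordered_idom neg_0_less_iff_less)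
    then show False
      using *[OF assms(1)] *[of "- p"] tendsto_minus[OF assms(1)] by cases auto
  qed
qed

lemma asymp_poly_unique':
  fixes p q :: "real poly"
  assumes "((\<lambda>t. f t - poly p (L t)) \<longlongrightarrow> 0) F" "((\<lambda>t. f t - poly q (L t)) \<longlongrightarrow> 0) F"
    "filterlim L at_top F" "F \<noteq> bot"
  shows "p = q"
proof -
  have "((\<lambda>t. poly (p - q) (L t)) \<longlongrightarrow> 0 - 0) F"
    using tendsto_diff[OF assms(2,1)] by (simp add: algebra_simps)
  then have "((\<lambda>t. poly (p - q) (L t)) \<longlongrightarrow> 0) F" by (simp only: diff_zero)
  then have "p - q = 0" by (rule poly_tendsto_0_imp_0) (rule assms)+
  then show ?thesis by simp
qed

section \<open>Regularization by asymptotic expansion\<close>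

text \<open>Common setting of both regularizations: \<open>h es\<close> is a cut-off version of the possibly divergent multiple
  zeta value, the cut-off being removed along the filter \<open>F\<close>, and pointwise products of these functions are
  given by the product rule \<open>prodl\<close>. The asymptotic polynomial of \<open>h es\<close> in \<open>h [0]\<close> (the cut-off
  version of \<open>\<zeta>(1)\<close>) then is the value of the regularization homomorphism, and its multiplicativity comes from
  that of real functions. The condition on \<open>prodl [0] es\<close> says that \<open>y\<close> times a word with \<open>k\<close> leading
  letters \<open>y\<close> is \<open>k + 1\<close> times the word with one more, plus words with at most \<open>k\<close> leading letters \<open>y\<close>;
  it makes every word a polynomial in \<open>y\<close> over \<open>H0\<close>.\<close>

locale regularized_product =
  fixes B :: "letter list \<Rightarrow> letter list \<Rightarrow> ncpoly"
    and prodl :: "nat list \<Rightarrow> nat list \<Rightarrow> nat list list"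
    and h :: "nat list \<Rightarrow> 'b \<Rightarrow> real"
    and F :: "'b filter"
  assumes B_exp_word: "B (exp_word es) (exp_word es') = (\<Sum>w\<leftarrow>prodl es es'. word (exp_word w))"
    and leading_prodl: "filter (\<lambda>v. leading_zeros es < leading_zeros v) (prodl [0] es)
            = replicate (Suc (leading_zeros es)) (0 # es)"
    and h_mult: "\<forall>\<^sub>F t in F. h es t * h es' t = (\<Sum>w\<leftarrow>prodl es es'. h w t)"
    and h_Nil: "h [] t = 1"
    and h_0: "filterlim (h [0]) at_top F"
    and F_neq_bot: "F \<noteq> bot"
    and h_tendsto: "((\<lambda>t. (h (Suc e # es) t - mzv (map Suc (Suc e # es))) * h [0] t ^ j) \<longlongrightarrow> 0) F"
begin

abbreviation "M \<equiv> bilinear_ext B"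
abbreviation "apoly \<equiv> asymp_poly F (h [0])"

definition lower_terms :: "nat list \<Rightarrow> nat list list" where
  "lower_terms es = filter (\<lambda>v. \<not> leading_zeros es < leading_zeros v) (prodl [0] es)"

lemma sum_list_prodl_0:
  fixes f :: "nat list \<Rightarrow> 'c :: comm_semiring_1"
  shows "(\<Sum>w\<leftarrow>prodl [0] es. f w)
     = of_nat (Suc (leading_zeros es)) * f (0 # es) + (\<Sum>w\<leftarrow>lower_terms es. f w)"
  unfolding lower_terms_def
  by (subst sum_list_partition[of _ _ "\<lambda>v. leading_zeros es < leading_zeros v"], subst leading_prodl)
     (simp only: map_replicate sum_list_replicate of_nat_mult)

lemma lower_terms_less: "v \<in> set (lower_terms es) \<Longrightarrow> leading_zeros v < leading_zeros (0 # es)"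
  by (auto simp: lower_terms_def)

lemma leading_zeros_induct [case_names adm step]:
  assumes "\<And>es. leading_zeros es = 0 \<Longrightarrow> P es"
    and "\<And>es. P es \<Longrightarrow> (\<And>v. v \<in> set (lower_terms es) \<Longrightarrow> P v) \<Longrightarrow> P (0 # es)"
  shows "P es"
proof (induction "leading_zeros es" arbitrary: es rule: less_induct)
  case less
  show ?case
  proof (cases es rule: leading_zeros.cases)
    case (1 es')
    then show ?thesis using less lower_terms_less[of _ es'] assms(2)[of es'] by auto
  qed (use assms(1) in auto)
qed

text \<open>Multiplication by \<open>y\<close> determines the values at words with leading letters \<open>y\<close> from those at admissible
  words.\<close>

lemma recursion_unique:
  fixes r r' :: "nat list \<Rightarrow> real poly"
  assumes "\<And>es. leading_zeros es = 0 \<Longrightarrow> r es = r' es"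
    and "\<And>es. (\<Sum>w\<leftarrow>prodl [0] es. r w) = [:0, 1:] * r es"
    and "\<And>es. (\<Sum>w\<leftarrow>prodl [0] es. r' w) = [:0, 1:] * r' es"
  shows "r es = r' es"
proof (induction es rule: leading_zeros_induct)
  case (step es)
  have "(\<Sum>w\<leftarrow>lower_terms es. r w) = (\<Sum>w\<leftarrow>lower_terms es. r' w)"
    by (rule arg_cong[of _ _ sum_list], rule map_cong) (use step in auto)
  then have "of_nat (Suc (leading_zeros es)) * r (0 # es) = of_nat (Suc (leading_zeros es)) * r' (0 # es)"
    using assms(2)[of es] assms(3)[of es] step.IH(1) unfolding sum_list_prodl_0 by (metis add_right_cancel)
  then show ?case using mult_left_cancel of_nat_neq_0 by blast
qed (use assms(1) in blast)

text \<open>The product rule with the first factor \<open>y\<close>, solved for the word with the most leading letters \<open>y\<close>.\<close>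

lemma asymp_exists: "\<exists>p. apoly (h es) p"
proof (induction es rule: leading_zeros_induct)
  case (adm es)
  show ?case
  proof (cases es)
    case Nil
    then have "apoly (h es) 1" by (intro asymp_poly_exact) (simp add: h_Nil)
    then show ?thesis ..
  next
    case (Cons e' es')
    with adm obtain e where e: "es = Suc e # es'" by (cases e') auto
    have "apoly (h es) [:mzv (map Suc es):]"
      by (rule asymp_polyI) (use h_tendsto e in simp)
    then show ?thesis ..
  qed
next
  case (step es)
  then obtain p q where p: "apoly (h es) p" and q: "\<And>v. v \<in> set (lower_terms es) \<Longrightarrow> apoly (h v) (q v)"
    by metis
  let ?k = "Suc (leading_zeros es)"
  have "apoly (h [0]) [:0, 1:]" by (rule asymp_poly_exact) simp
  from asymp_poly_mult[OF this p]
  have "apoly (\<lambda>t. \<Sum>w\<leftarrow>prodl [0] es. h w t) ([:0, 1:] * p)"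
    by (rule asymp_poly_cong) (rule h_mult)
  then have "apoly (\<lambda>t. of_nat ?k * h (0 # es) t + (\<Sum>w\<leftarrow>lower_terms es. h w t)) ([:0, 1:] * p)"
    unfolding sum_list_prodl_0 .
  moreover have "apoly (\<lambda>t. \<Sum>w\<leftarrow>lower_terms es. h w t) (\<Sum>w\<leftarrow>lower_terms es. q w)"
    by (rule asymp_poly_sum_list) (rule q)
  ultimately have "apoly (\<lambda>t. inverse (of_nat ?k) * (of_nat ?k * h (0 # es) t + (\<Sum>w\<leftarrow>lower_terms es. h w t)
      + (-1) * (\<Sum>w\<leftarrow>lower_terms es. h w t)))
     (smult (inverse (of_nat ?k)) ([:0, 1:] * p + smult (-1) (\<Sum>w\<leftarrow>lower_terms es. q w)))"
    by (intro asymp_poly_cmult asymp_poly_add)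
  moreover have cancel: "inverse (of_nat ?k) * (of_nat ?k * x + y + (-1) * y) = x" for x y :: real
    by (simp del: of_nat_Suc flip: mult.assoc)
  ultimately show ?case unfolding cancel by blast
qed

definition R :: "nat list \<Rightarrow> real poly" where
  "R es = (SOME p. apoly (h es) p)"

lemma asymp_R: "apoly (h es) (R es)"
  unfolding R_def using asymp_exists by (rule someI_ex)

text \<open>An error tending to \<open>0\<close> suffices to identify a polynomial, once its existence is known.\<close>

lemma R_eqI: "((\<lambda>t. h es t - poly p (h [0] t)) \<longlongrightarrow> 0) F \<Longrightarrow> R es = p"
  by (rule asymp_poly_unique'[OF asymp_poly_tendsto[OF asymp_R]]) (use h_0 F_neq_bot in auto)

lemma R_adm: "R (Suc e # es) = [:mzv (map Suc (Suc e # es)):]"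
  using h_tendsto[of e es 0] by (intro R_eqI) simp

lemma R_Nil [simp]: "R [] = 1"
  by (rule R_eqI) (simp add: h_Nil)

lemma R_0 [simp]: "R [0] = [:0, 1:]"
  by (rule R_eqI) simp

lemma asymp_unique: "apoly f p \<Longrightarrow> apoly f q \<Longrightarrow> p = q"
  using asymp_poly_unique'[OF asymp_poly_tendsto asymp_poly_tendsto h_0 F_neq_bot] by blast

lemma R_mult: "R es * R es' = (\<Sum>w\<leftarrow>prodl es es'. R w)"
proof (rule asymp_unique)
  show "apoly (\<lambda>t. \<Sum>w\<leftarrow>prodl es es'. h w t) (R es * R es')"
    by (rule asymp_poly_cong[OF asymp_poly_mult h_mult]) (rule asymp_R)+
  show "apoly (\<lambda>t. \<Sum>w\<leftarrow>prodl es es'. h w t) (\<Sum>w\<leftarrow>prodl es es'. R w)"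
    by (rule asymp_poly_sum_list) (rule asymp_R)
qed

lemma M_in_H1:
  assumes "p \<in> H1" "q \<in> H1"
  shows "M p q \<in> H1"
proof -
  have "B u v \<in> H1" if "u \<in> range exp_word" "v \<in> range exp_word" for u v
    using that by (auto simp: B_exp_word intro!: H1_sum_list word_exp_word_H1)
  then show ?thesis unfolding bilinear_ext_def
    using keys_H1[OF assms(1)] keys_H1[OF assms(2)] by (intro H1_sum H1_scale) (simp add: subset_iff)
qed

lemma linear_ext_M:
  assumes "p \<in> H1" "q \<in> H1"
  shows "linear_ext R (M p q) = linear_ext R p * linear_ext R q"
proof -
  have "linear_ext R (B u v) = R (exponents u) * R (exponents v)"
    if "u \<in> range exp_word" "v \<in> range exp_word" for u v
    using that by (auto simp: B_exp_word linear_ext_sum_list R_mult)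
  then have "linear_ext R (M p q) = (\<Sum>u\<in>Poly_Mapping.keys p. \<Sum>v\<in>Poly_Mapping.keys q.
        smult (of_rat (Poly_Mapping.lookup p u * Poly_Mapping.lookup q v)) (R (exponents u) * R (exponents v)))"
    unfolding bilinear_ext_def linear_ext_sum linear_ext_scale
    using keys_H1[OF assms(1)] keys_H1[OF assms(2)] by (intro sum.cong refl) (auto simp: subset_iff)
  also have "\<dots> = linear_ext R p * linear_ext R q"
    by (simp add: linear_ext_def sum_product of_rat_mult mult_smult_left mult_smult_right mult.commute)
  finally show ?thesis .
qed

lemma linear_ext_H0:
  assumes "p \<in> H0"
  shows "linear_ext R p = [:Zeval p:]"
proof -
  have *: "R (exponents w) = [:mzv (index_of w):]" if "w \<in> Poly_Mapping.keys p" for w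
    using assms that
  proof (cases rule: keys_H0)
    case 1
    have "exponents [] = []" "index_of [] = []" by (auto simp: exponents_def index_of_def)
    moreover have "mzv [] = 1"
    proof -
      have "{ms :: nat list. length ms = length [] \<and> sorted_wrt (>) ms \<and> (\<forall>m\<in>set ms. 0 < m)} = {[]}"
        by auto
      then show ?thesis by (simp add: mzv_def)
    qed
    ultimately show ?thesis using 1 by (simp add: one_pCons)
  next
    case (2 e es)
    show ?thesis unfolding 2 exponents_exp_word' index_of_exp_word' by (rule R_adm)
  qed
  have "linear_ext R p = (\<Sum>w\<in>Poly_Mapping.keys p. [:of_rat (Poly_Mapping.lookup p w) * mzv (index_of w):])"
    unfolding linear_ext_def by (intro sum.cong refl) (simp add: *)
  also have "\<dots> = [:Zeval p:]"
    unfolding Zeval_def by (induction rule: infinite_finite_induct) auto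
  finally show ?thesis .
qed

lemma linear_ext_is_regularization: "is_regularization M (restrict (linear_ext R) H1)"
  unfolding is_regularization_def
proof (intro conjI ballI allI)
  show "restrict (linear_ext R) H1 1 = 1"
    using word_exp_word_H1[of "[]"] linear_ext_word[of R "[]"] exponents_exp_word'[of "[]"] by (simp add: word_Nil)
  have y: "nc_y = word (exp_word [0])" by (simp add: nc_y_def)
  show "restrict (linear_ext R) H1 nc_y = [:0, 1:]"
    using word_exp_word_H1[of "[0]"] unfolding y by (simp only: restrict_apply' linear_ext_word exponents_exp_word' R_0)
qed (use H0_subset_H1 in \<open>auto simp: linear_ext_add linear_ext_scale linear_ext_M linear_ext_H0 H1_add H1_scale M_in_H1\<close>)

lemma regularization_word:
  assumes "is_regularization M \<phi>"
  shows "\<phi> (word (exp_word es)) = R es"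
proof -
  have add: "\<phi> (p + q) = \<phi> p + \<phi> q" if "p \<in> H1" "q \<in> H1" for p q
    using assms that by (auto simp: is_regularization_def)
  have zero: "\<phi> 0 = 0" using add[OF H1_0 H1_0] by simp
  have sum_list: "\<phi> (\<Sum>w\<leftarrow>ws. word (exp_word w)) = (\<Sum>w\<leftarrow>ws. \<phi> (word (exp_word w)))" for ws
    by (induction ws) (auto simp: zero add H1_sum_list word_exp_word_H1)
  show ?thesis
  proof (rule recursion_unique)
    fix es
    assume "leading_zeros es = 0"
    then consider "es = []" | e es' where "es = Suc e # es'"
      by (cases es rule: leading_zeros.cases) auto
    then show "\<phi> (word (exp_word es)) = R es"
    proof cases
      case 1
      then show ?thesis using assms by (simp add: word_Nil is_regularization_def)
    next
      case 2
      have "\<phi> (word (exp_word (Suc e # es'))) = [:Zeval (word (exp_word (Suc e # es'))):]"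
        using assms word_in_H0[of e es'] by (auto simp: is_regularization_def simp del: exp_word_Cons)
      also have "Zeval (word (exp_word (Suc e # es'))) = mzv (map Suc (Suc e # es'))"
        by (simp add: Zeval_def lookup_word del: exp_word_Cons)
      finally show ?thesis using 2 R_adm by simp
    qed
  next
    fix es
    have y: "nc_y = word (exp_word [0])" by (simp add: nc_y_def)
    have "M nc_y (word (exp_word es)) = (\<Sum>w\<leftarrow>prodl [0] es. word (exp_word w))"
      unfolding y bilinear_ext_def by (simp add: lookup_word B_exp_word del: exp_word_Cons)
    then have "(\<Sum>w\<leftarrow>prodl [0] es. \<phi> (word (exp_word w))) = \<phi> (M nc_y (word (exp_word es)))"
      by (simp add: sum_list)
    also have "\<dots> = \<phi> nc_y * \<phi> (word (exp_word es))"
      using assms word_exp_word_H1[of "[0]"] word_exp_word_H1[of es] y by (auto simp: is_regularization_def)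
    also have "\<phi> nc_y = [:0, 1:]" using assms by (auto simp: is_regularization_def)
    finally show "(\<Sum>w\<leftarrow>prodl [0] es. \<phi> (word (exp_word w))) = [:0, 1:] * \<phi> (word (exp_word es))" .
  next
    show "(\<Sum>w\<leftarrow>prodl [0] es. R w) = [:0, 1:] * R es" for es
      by (simp flip: R_mult)
  qed
qed

lemma regularization_unique:
  assumes "is_regularization M \<phi>" "\<phi> \<in> extensional H1"
  shows "\<phi> = restrict (linear_ext R) H1"
proof (rule extensionalityI[OF assms(2)])
  show "restrict (linear_ext R) H1 \<in> extensional H1" by simp
  fix p assume p: "p \<in> H1"
  have add: "\<phi> (p + q) = \<phi> p + \<phi> q" if "p \<in> H1" "q \<in> H1" for p q
    using assms that by (auto simp: is_regularization_def)
  have zero: "\<phi> 0 = 0" using add[OF H1_0 H1_0] by simp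
  have scale: "\<phi> (scalar c * p) = smult (of_rat c) (\<phi> p)" if "p \<in> H1" for c p
    using assms that by (auto simp: is_regularization_def)
  have sum: "\<phi> (sum f A) = (\<Sum>i\<in>A. \<phi> (f i))" if "\<And>i. i \<in> A \<Longrightarrow> f i \<in> H1" for f :: "letter list \<Rightarrow> ncpoly" and A
    using that by (induction A rule: infinite_finite_induct) (auto simp: zero add H1_sum)
  have H1w: "word w \<in> H1" "\<phi> (word w) = R (exponents w)" if "w \<in> Poly_Mapping.keys p" for w
    using that keys_H1[OF p] word_exp_word_H1 regularization_word[OF assms(1)] by auto
  have "\<phi> p = \<phi> (\<Sum>w\<in>Poly_Mapping.keys p. scalar (Poly_Mapping.lookup p w) * word w)"
    using ncpoly_expand[of p] by simp
  also have "\<dots> = (\<Sum>w\<in>Poly_Mapping.keys p. \<phi> (scalar (Poly_Mapping.lookup p w) * word w))"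
    by (rule sum) (intro H1_scale H1w)
  also have "\<dots> = linear_ext R p"
    unfolding linear_ext_def by (intro sum.cong refl) (simp add: scale H1w)
  finally show "\<phi> p = restrict (linear_ext R) H1 p" using p by simp
qed

text \<open>This discharges the definite description: the homomorphism exists and is unique.\<close>

lemma regularization_eq: "regularization M = restrict (linear_ext R) H1"
  unfolding regularization_def
  by (rule the_equality) (auto simp: linear_ext_is_regularization intro: regularization_unique)

lemma regularization_zgen: "regularization M (\<Prod>l\<leftarrow>map Suc es. zgen l) = R es"
  unfolding prod_list_zgen regularization_eq using word_exp_word_H1[of es] by simp

end

section \<open>Truncated sums and the harmonic type\<close>

text \<open>The terms of the harmonic product, in exponents: merging \<open>z\<^bsub>a+1\<^esub>\<close> and \<open>z\<^bsub>b+1\<^esub>\<close> to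
  \<open>z\<^bsub>a+b+2\<^esub>\<close> gives the exponent \<open>a + b + 1\<close>.\<close>

fun stuffle_list :: "nat list \<Rightarrow> nat list \<Rightarrow> nat list list" where
  "stuffle_list [] v = [v]"
| "stuffle_list (a # u) [] = [a # u]"
| "stuffle_list (a # u) (b # v) =
     map ((#) a) (stuffle_list u (b # v)) @ map ((#) b) (stuffle_list (a # u) v)
     @ map ((#) (Suc (a + b))) (stuffle_list u v)"

lemma sum_list_word_exp_word_Cons:
  "(\<Sum>w\<leftarrow>ws. word (exp_word (a # w))) = zgen (Suc a) * (\<Sum>w\<leftarrow>ws. word (exp_word w))"
proof -
  have "word (exp_word (a # w)) = zgen (Suc a) * word (exp_word w)" for w
    by (simp add: zgen_Suc flip: word_append)
  then show ?thesis by (simp only: sum_list_const_mult)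
qed

lemma harmonic_index_stuffle:
  "harmonic_index (map Suc es) (map Suc es') = (\<Sum>w\<leftarrow>stuffle_list es es'. word (exp_word w))"
proof (induction es es' rule: stuffle_list.induct)
  case (1 v)
  show ?case unfolding list.map harmonic_index.simps prod_list_zgen by simp
next
  case (2 a u)
  show ?case unfolding list.map harmonic_index.simps prod_list_zgen[of "a # u", unfolded list.map] by simp
next
  case (3 a u b v)
  show ?case
    using 3 by (simp add: o_def sum_list_word_exp_word_Cons algebra_simps del: exp_word_Cons)
qed

lemma leading_zeros_stuffle:
  "filter (\<lambda>v. leading_zeros es < leading_zeros v) (stuffle_list [0] es)
     = replicate (Suc (leading_zeros es)) (0 # es)"
proof (induction es)
  case (Cons b v)
  show ?case
  proof (cases b)
    case 0
    then show ?thesis using Cons by (simp add: filter_map o_def map_replicate replicate_append_same)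
  next
    case (Suc b')
    then show ?thesis by (simp add: filter_map o_def)
  qed
qed auto

text \<open>The sum defining the multiple zeta value, restricted to \<open>N \<ge> m\<^sub>1\<close>; in the formula the summation
  variable is \<open>m\<^sub>1 - 1\<close>.\<close>

fun trunc :: "nat list \<Rightarrow> nat \<Rightarrow> real" where
  "trunc [] N = 1"
| "trunc (e # es) N = (\<Sum>m<N. trunc es m / real (Suc m) ^ Suc e)"

text \<open>Products of truncated sums are harmonic products: the largest summation variable comes from the first
  factor, from the second, or from both. By induction on the truncation.\<close>

lemma trunc_mult: "trunc es N * trunc es' N = (\<Sum>w\<leftarrow>stuffle_list es es'. trunc w N)"
proof (induction N arbitrary: es es')
  case 0
  show ?case by (induction es es' rule: stuffle_list.induct) (auto simp: o_def)
next
  case (Suc N)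
  have split: "(\<Sum>w\<leftarrow>ws. trunc (e # w) (Suc N))
     = (\<Sum>w\<leftarrow>ws. trunc (e # w) N) + (\<Sum>w\<leftarrow>ws. trunc w N) / real (Suc N) ^ Suc e" for ws e
    by (induction ws) (auto simp: add_divide_distrib simp del: of_nat_Suc power_Suc)
  show ?case
  proof (cases "es = [] \<or> es' = []")
    case True
    then show ?thesis by (cases es) auto
  next
    case False
    then obtain a u b v where [simp]: "es = a # u" "es' = b # v" by (metis neq_Nil_conv)
    define A B where "A = trunc (a # u) N" and "B = trunc (b # v) N"
    let ?a = "trunc u N" and ?b = "trunc v N" and ?r = "real (Suc N)"
    have A: "trunc (a # u) (Suc N) = A + ?a / ?r ^ Suc a" by (simp add: A_def)
    have B: "trunc (b # v) (Suc N) = B + ?b / ?r ^ Suc b" by (simp add: B_def)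
    have sum0: "A * B = (\<Sum>w\<leftarrow>stuffle_list u (b # v). trunc (a # w) N)
      + (\<Sum>w\<leftarrow>stuffle_list (a # u) v. trunc (b # w) N) + (\<Sum>w\<leftarrow>stuffle_list u v. trunc (Suc (a + b) # w) N)"
      using Suc.IH[of es es'] unfolding A_def B_def by (simp add: o_def)
    have sum1: "(\<Sum>w\<leftarrow>stuffle_list u (b # v). trunc w N) = ?a * B"
      "(\<Sum>w\<leftarrow>stuffle_list (a # u) v. trunc w N) = A * ?b"
      "(\<Sum>w\<leftarrow>stuffle_list u v. trunc w N) = ?a * ?b"
      using Suc.IH[of u "b # v"] Suc.IH[of "a # u" v] Suc.IH[of u v] by (simp_all only: A_def B_def)
    have "(\<Sum>w\<leftarrow>stuffle_list es es'. trunc w (Suc N))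
      = (\<Sum>w\<leftarrow>stuffle_list u (b # v). trunc (a # w) (Suc N))
      + (\<Sum>w\<leftarrow>stuffle_list (a # u) v. trunc (b # w) (Suc N))
      + (\<Sum>w\<leftarrow>stuffle_list u v. trunc (Suc (a + b) # w) (Suc N))"
      by (simp add: o_def del: trunc.simps)
    also have "\<dots> = A * B + ?a * B / ?r ^ Suc a + A * ?b / ?r ^ Suc b + ?a * ?b / ?r ^ Suc (Suc (a + b))"
      unfolding split sum0 sum1 by (simp del: of_nat_Suc power_Suc)
    also have "\<dots> = (A + ?a / ?r ^ Suc a) * (B + ?b / ?r ^ Suc b)"
    proof -
      have "?r ^ Suc (Suc (a + b)) = ?r ^ Suc a * ?r ^ Suc b" by (simp add: power_add)
      then show ?thesis by (simp add: algebra_simps del: of_nat_Suc power_Suc)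
    qed
    finally show ?thesis using A B by simp
  qed
qed

lemma trunc_0_harm: "trunc [0] N = harm N"
  by (simp add: harm_altdef inverse_eq_divide)

lemma trunc_nonneg: "0 \<le> trunc es N"
  by (induction es arbitrary: N) (auto intro!: sum_nonneg divide_nonneg_nonneg)

lemma trunc_le_harm: "trunc es N \<le> harm N ^ length es"
proof (induction es arbitrary: N)
  case (Cons e es)
  have "trunc (e # es) N \<le> (\<Sum>m<N. harm N ^ length es * inverse (real (Suc m)))"
    unfolding trunc.simps
  proof (rule sum_mono)
    fix m assume m: "m \<in> {..<N}"
    have "trunc es m \<le> harm N ^ length es"
      using m by (intro order_trans[OF Cons.IH power_mono] harm_mono harm_nonneg) simp
    moreover have "1 / real (Suc m) ^ Suc e \<le> 1 / real (Suc m)"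
      by (intro divide_left_mono) auto
    ultimately have "trunc es m * (1 / real (Suc m) ^ Suc e) \<le> harm N ^ length es * (1 / real (Suc m))"
      by (intro mult_mono) (auto simp: trunc_nonneg harm_nonneg)
    then show "trunc es m / real (Suc m) ^ Suc e \<le> harm N ^ length es * inverse (real (Suc m))"
      by (simp add: inverse_eq_divide)
  qed
  also have "\<dots> = harm N ^ length (e # es)"
    by (simp add: harm_altdef sum_distrib_left sum_distrib_right mult.commute)
  finally show ?case .
qed auto

text \<open>Powers of the logarithm are absorbed by arbitrarily small powers; this makes all error terms
  negligible against powers of the divergent quantities.\<close>

lemma ln_power_bound:
  fixes r :: real
  assumes "r > 0"
  obtains C where "C > 0" "\<And>x. x \<ge> 1 \<Longrightarrow> (1 + ln x) ^ q \<le> C * x powr r"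
proof -
  define \<epsilon> where "\<epsilon> = r / real (Suc q)"
  have \<epsilon>: "\<epsilon> > 0" using assms by (simp add: \<epsilon>_def)
  define C where "C = (1 + 1 / \<epsilon>) ^ q"
  have "(1 + ln x) ^ q \<le> C * x powr r" if x: "x \<ge> 1" for x
  proof -
    have "1 \<le> x powr \<epsilon>" using x \<epsilon> by (simp add: ge_one_powr_ge_zero)
    moreover have "ln x \<le> x powr \<epsilon> / \<epsilon>" by (rule ln_powr_bound) (use x \<epsilon> in auto)
    ultimately have "1 + ln x \<le> (1 + 1 / \<epsilon>) * x powr \<epsilon>" by (simp add: algebra_simps)
    then have "(1 + ln x) ^ q \<le> ((1 + 1 / \<epsilon>) * x powr \<epsilon>) ^ q"
      using x by (intro power_mono) auto
    also have "\<dots> = C * x powr (\<epsilon> * real q)"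
      using x by (simp add: C_def power_mult_distrib powr_power mult.commute)
    also have "\<dots> \<le> C * x powr r"
    proof (intro mult_left_mono powr_mono)
      have "real q \<le> real (Suc q)" by simp
      then have "\<epsilon> * real q \<le> \<epsilon> * real (Suc q)" using \<epsilon> by (intro mult_left_mono) auto
      then show "\<epsilon> * real q \<le> r" by (simp add: \<epsilon>_def)
    qed (use x \<epsilon> in \<open>auto simp: C_def\<close>)
    finally show ?thesis .
  qed
  moreover have "C > 0" using \<epsilon> by (auto simp: C_def intro!: zero_less_power add_pos_pos)
  ultimately show ?thesis using that by blast
qed

lemma harm_le_ln: "harm m \<le> 1 + ln (real (Suc m))"
proof (cases "m = 0")
  case False
  then have "harm m - ln (real m) \<le> harm 1 - ln (real 1)"
    using euler_mascheroni_sequence_decreasing[of 1 m] by simp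
  then have "harm m \<le> 1 + ln (real m)" by (simp add: harm_def)
  also have "\<dots> \<le> 1 + ln (real (Suc m))" using False by simp
  finally show ?thesis .
qed (simp add: harm_def)

lemma harm_power_bound:
  assumes "r > 0"
  obtains C where "C > 0" "\<And>m. harm m ^ q \<le> C * real (Suc m) powr r"
proof -
  obtain C where C: "C > 0" "\<And>x. x \<ge> 1 \<Longrightarrow> (1 + ln x) ^ q \<le> C * x powr r"
    using ln_power_bound[OF assms] by blast
  have "harm m ^ q \<le> C * real (Suc m) powr r" for m
  proof -
    have "harm m ^ q \<le> (1 + ln (real (Suc m))) ^ q"
      by (intro power_mono harm_le_ln harm_nonneg)
    also have "\<dots> \<le> C * real (Suc m) powr r" by (rule C) simp
    finally show ?thesis .
  qed
  with C(1) show ?thesis using that by blast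
qed

text \<open>Any exponent below \<open>-1\<close> would do for the tails of the series, but comparing the power series at
  \<open>t < 1\<close> with its value at \<open>1\<close> costs another factor \<open>m\<^bsup>1/2\<^esup>\<close>.\<close>

lemma coefficient_bound:
  obtains C where "C > 0"
    "\<And>m. trunc es m / real (Suc m) ^ Suc (Suc e) * harm m ^ j \<le> C * real (Suc m) powr (- 7 / 4)"
proof -
  obtain C where C: "C > 0" "\<And>m. harm m ^ (length es + j) \<le> C * real (Suc m) powr (1 / 4)"
    using harm_power_bound[of "1 / 4"] by auto
  have "trunc es m / real (Suc m) ^ Suc (Suc e) * harm m ^ j \<le> C * real (Suc m) powr (- 7 / 4)" for m
  proof -
    have "trunc es m / real (Suc m) ^ Suc (Suc e) * harm m ^ j
       = (trunc es m * harm m ^ j) * (1 / real (Suc m) ^ Suc (Suc e))" by simp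
    also have "\<dots> \<le> harm m ^ (length es + j) * (1 / real (Suc m) ^ 2)"
    proof (rule mult_mono)
      show "trunc es m * harm m ^ j \<le> harm m ^ (length es + j)"
        unfolding power_add by (intro mult_right_mono trunc_le_harm zero_le_power harm_nonneg)
      have "real (Suc m) ^ 2 \<le> real (Suc m) ^ Suc (Suc e)" by (intro power_increasing) auto
      then show "1 / real (Suc m) ^ Suc (Suc e) \<le> 1 / real (Suc m) ^ 2"
        by (intro divide_left_mono) auto
    qed (auto simp: harm_nonneg)
    also have "\<dots> \<le> (C * real (Suc m) powr (1 / 4)) * (1 / real (Suc m) ^ 2)"
      by (intro mult_right_mono C) auto
    also have "1 / real (Suc m) ^ 2 = real (Suc m) powr (- 2)"
      by (simp add: powr_minus_divide powr_numeral)
    also have "C * real (Suc m) powr (1 / 4) * real (Suc m) powr - 2 = C * real (Suc m) powr (- 7 / 4)"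
      by (simp flip: powr_add)
    finally show ?thesis .
  qed
  with C(1) show ?thesis using that by blast
qed

lemma summable_Suc_powr: "r < -1 \<Longrightarrow> summable (\<lambda>m. real (Suc m) powr r)"
  by (subst summable_Suc_iff) (simp add: summable_real_powr_iff)

lemma summable_coefficients:
  "summable (\<lambda>m. trunc es m / real (Suc m) ^ Suc (Suc e) * harm m ^ j)"
proof -
  obtain C where C: "\<And>m. trunc es m / real (Suc m) ^ Suc (Suc e) * harm m ^ j \<le> C * real (Suc m) powr (- 7 / 4)"
    using coefficient_bound by blast
  show ?thesis
  proof (rule summable_comparison_test)
    show "summable (\<lambda>m. C * real (Suc m) powr (- 7 / 4))"
      by (intro summable_mult summable_Suc_powr) simp
    show "\<exists>N. \<forall>n\<ge>N. norm (trunc es n / real (Suc n) ^ Suc (Suc e) * harm n ^ j) \<le> C * real (Suc n) powr (- 7 / 4)"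
      using C by (auto simp: trunc_nonneg harm_nonneg)
  qed
qed

definition decreasing :: "nat \<Rightarrow> nat \<Rightarrow> nat list set" where
  "decreasing n N = {ms. length ms = n \<and> sorted_wrt (>) ms \<and> (\<forall>m\<in>set ms. 0 < m \<and> m \<le> N)}"

definition mzv_term :: "nat list \<Rightarrow> nat list \<Rightarrow> real" where
  "mzv_term ks ms = 1 / (\<Prod>i<length ks. real (ms ! i) ^ (ks ! i))"

lemma decreasing_Suc:
  "decreasing (Suc n) N = (\<lambda>(m, ms). Suc m # ms) ` (SIGMA m:{..<N}. decreasing n m)"
proof (intro equalityI subsetI)
  fix x assume x: "x \<in> decreasing (Suc n) N"
  then obtain k ms where k: "x = k # ms" "0 < k" by (cases x) (auto simp: decreasing_def)
  then have "x = (\<lambda>(m, ms). Suc m # ms) (k - 1, ms)" by simp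
  moreover have "(k - 1, ms) \<in> (SIGMA m:{..<N}. decreasing n m)"
    using x k by (fastforce simp: decreasing_def)
  ultimately show "x \<in> (\<lambda>(m, ms). Suc m # ms) ` (SIGMA m:{..<N}. decreasing n m)" by blast
next
  fix x assume "x \<in> (\<lambda>(m, ms). Suc m # ms) ` (SIGMA m:{..<N}. decreasing n m)"
  then show "x \<in> decreasing (Suc n) N" by (fastforce simp: decreasing_def)
qed

lemma finite_decreasing: "finite (decreasing n N)"
proof (induction n arbitrary: N)
  case 0
  have "decreasing 0 N \<subseteq> {[]}" by (auto simp: decreasing_def)
  then show ?case using finite_subset by blast
next
  case (Suc n)
  then show ?case unfolding decreasing_Suc by (intro finite_imageI finite_SigmaI) auto
qed

lemma trunc_eq_sum: "trunc es N = (\<Sum>ms\<in>decreasing (length es) N. mzv_term (map Suc es) ms)"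
proof (induction es arbitrary: N)
  case Nil
  have "decreasing 0 N = {[]}" by (auto simp: decreasing_def)
  then show ?case by (simp add: mzv_term_def)
next
  case (Cons e es)
  have inj: "inj_on (\<lambda>(m, ms). Suc m # ms) A" for A by (auto simp: inj_on_def)
  have "(\<Sum>ms\<in>decreasing (length (e # es)) N. mzv_term (map Suc (e # es)) ms)
      = (\<Sum>(m, ms)\<in>(SIGMA m:{..<N}. decreasing (length es) m). mzv_term (map Suc (e # es)) (Suc m # ms))"
    unfolding list.size(4) Nat.add_0_right add_Suc_right decreasing_Suc
    by (subst sum.reindex[OF inj]) (simp add: case_prod_unfold o_def del: list.map)
  also have "\<dots> = (\<Sum>m<N. \<Sum>ms\<in>decreasing (length es) m. mzv_term (map Suc (e # es)) (Suc m # ms))"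
    by (intro sum.Sigma[symmetric]) (auto simp: finite_decreasing)
  also have "\<dots> = (\<Sum>m<N. \<Sum>ms\<in>decreasing (length es) m. mzv_term (map Suc es) ms / real (Suc m) ^ Suc e)"
  proof -
    have "mzv_term (map Suc (e # es)) (Suc m # ms) = mzv_term (map Suc es) ms / real (Suc m) ^ Suc e" for m ms
      unfolding mzv_term_def length_map list.size(4) Nat.add_0_right add_Suc_right
      by (subst prod.lessThan_Suc_shift) simp
    then show ?thesis by simp
  qed
  finally show ?case by (simp add: Cons.IH sum_divide_distrib)
qed

lemma mzv_term_nonneg: "0 \<le> mzv_term ks ms"
  by (auto simp: mzv_term_def intro!: divide_nonneg_nonneg prod_nonneg)

lemma decreasing_mono: "M \<le> N \<Longrightarrow> decreasing n M \<subseteq> decreasing n N"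
  by (auto simp: decreasing_def)

text \<open>All terms are nonnegative and the truncations exhaust the index set, so the unordered sum is the
  limit of the truncated sums.\<close>

lemma mzv_eqI:
  assumes "trunc es \<longlonglongrightarrow> c"
  shows "mzv (map Suc es) = c"
proof -
  define D where "D = {ms. length ms = length es \<and> sorted_wrt (>) ms \<and> (\<forall>m\<in>set ms. 0 < (m::nat))}"
  have exhaust: "\<exists>N. A \<subseteq> decreasing (length es) N" if "finite A" "A \<subseteq> D" for A
  proof -
    have "A \<subseteq> decreasing (length es) (Max (insert 0 (\<Union>(set ` A))))"
      using that by (fastforce simp: decreasing_def D_def intro!: Max_ge)
    then show ?thesis ..
  qed
  have sub: "decreasing (length es) N \<subseteq> D" for N by (auto simp: decreasing_def D_def)
  have "incseq (trunc es)"
    unfolding incseq_def trunc_eq_sum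
    by (intro allI impI sum_mono2 finite_decreasing decreasing_mono mzv_term_nonneg)
  then have le: "trunc es N \<le> c" for N by (rule incseq_le[OF _ assms])
  have "mzv_term (map Suc es) summable_on D"
  proof (rule nonneg_bdd_above_summable_on)
    show "bdd_above (sum (mzv_term (map Suc es)) ` {A. A \<subseteq> D \<and> finite A})"
    proof (rule bdd_aboveI2)
      fix A assume "A \<in> {A. A \<subseteq> D \<and> finite A}"
      then obtain N where "A \<subseteq> decreasing (length es) N" using exhaust[of A] by blast
      then have "sum (mzv_term (map Suc es)) A \<le> trunc es N"
        unfolding trunc_eq_sum by (intro sum_mono2 finite_decreasing mzv_term_nonneg)
      then show "sum (mzv_term (map Suc es)) A \<le> c" using le[of N] by simp
    qed
  qed (rule mzv_term_nonneg)
  then have "(sum (mzv_term (map Suc es)) \<longlongrightarrow> infsum (mzv_term (map Suc es)) D) (finite_subsets_at_top D)"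
    using has_sum_infsum has_sum_def by blast
  moreover have "filterlim (decreasing (length es)) (finite_subsets_at_top D) sequentially"
    unfolding filterlim_finite_subsets_at_top
  proof (intro allI impI)
    fix X assume "finite X \<and> X \<subseteq> D"
    then obtain N where N: "X \<subseteq> decreasing (length es) N" using exhaust[of X] by blast
    show "\<forall>\<^sub>F y in sequentially. finite (decreasing (length es) y) \<and> X \<subseteq> decreasing (length es) y \<and> decreasing (length es) y \<subseteq> D"
      using eventually_ge_at_top[of N]
      by eventually_elim (use N decreasing_mono finite_decreasing sub in blast)
  qed
  ultimately have "(\<lambda>N. sum (mzv_term (map Suc es)) (decreasing (length es) N)) \<longlonglongrightarrow> infsum (mzv_term (map Suc es)) D"
    by (rule filterlim_compose)
  then have "trunc es \<longlonglongrightarrow> infsum (mzv_term (map Suc es)) D"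
    by (simp add: trunc_eq_sum[abs_def])
  then have "infsum (mzv_term (map Suc es)) D = c" using LIMSEQ_unique assms by blast
  then show ?thesis by (simp add: mzv_def D_def mzv_term_def[abs_def])
qed

lemma mzv_sums:
  "(\<lambda>m. trunc es m / real (Suc m) ^ Suc (Suc e)) sums mzv (map Suc (Suc e # es))"
proof -
  have "summable (\<lambda>m. trunc es m / real (Suc m) ^ Suc (Suc e))"
    using summable_coefficients[of es e 0] by simp
  then obtain c where c: "(\<lambda>m. trunc es m / real (Suc m) ^ Suc (Suc e)) sums c"
    by (auto simp: summable_def)
  moreover have "trunc (Suc e # es) = (\<lambda>N. \<Sum>m<N. trunc es m / real (Suc m) ^ Suc (Suc e))"
    by (rule ext) (rule trunc.simps)
  ultimately have "trunc (Suc e # es) \<longlonglongrightarrow> c" by (simp only: sums_def)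
  then have "mzv (map Suc (Suc e # es)) = c" by (rule mzv_eqI)
  with c show ?thesis by simp
qed

text \<open>The factor \<open>harm N ^ j\<close> can be moved into the tail of the series, where it is dominated by
  \<open>harm m ^ j\<close>, and what results is the tail of a convergent series.\<close>

lemma trunc_tendsto_mzv:
  "(\<lambda>N. (trunc (Suc e # es) N - mzv (map Suc (Suc e # es))) * harm N ^ j) \<longlonglongrightarrow> 0"
proof -
  define a where "a m = trunc es m / real (Suc m) ^ Suc (Suc e)" for m
  define b where "b m = a m * harm m ^ j" for m
  have a0: "a m \<ge> 0" for m by (simp add: a_def trunc_nonneg)
  have b: "summable b" unfolding b_def a_def by (rule summable_coefficients)
  have a: "a sums mzv (map Suc (Suc e # es))" unfolding a_def by (rule mzv_sums)
  have tail: "(\<lambda>N. suminf b - (\<Sum>m<N. b m)) \<longlonglongrightarrow> 0"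
    using tendsto_diff[OF tendsto_const summable_LIMSEQ[OF b], of "suminf b"] by simp
  show ?thesis
  proof (rule Lim_null_comparison[OF _ tail], rule always_eventually, rule allI)
    fix N
    have "trunc (Suc e # es) N = (\<Sum>m<N. a m)" by (simp only: trunc.simps a_def)
    then have "mzv (map Suc (Suc e # es)) - trunc (Suc e # es) N = suminf (\<lambda>m. a (m + N))"
      using suminf_minus_initial_segment[OF sums_summable[OF a], of N] sums_unique[OF a]
      by (simp del: trunc.simps list.map)
    then have "norm ((trunc (Suc e # es) N - mzv (map Suc (Suc e # es))) * harm N ^ j) = suminf (\<lambda>m. a (m + N)) * harm N ^ j"
      using suminf_nonneg[of "\<lambda>m. a (m + N)"] a0 sums_summable[OF a]
      by (simp add: abs_mult harm_nonneg summable_ignore_initial_segment)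
    also have "\<dots> = suminf (\<lambda>m. a (m + N) * harm N ^ j)"
      using sums_summable[OF a] by (intro suminf_mult2) (simp add: summable_ignore_initial_segment)
    also have "\<dots> \<le> suminf (\<lambda>m. b (m + N))"
    proof (rule suminf_le)
      show "a (m + N) * harm N ^ j \<le> b (m + N)" for m
        unfolding b_def by (intro mult_left_mono power_mono harm_mono harm_nonneg a0) simp
      show "summable (\<lambda>m. a (m + N) * harm N ^ j)"
        using sums_summable[OF a] by (intro summable_mult2) (simp add: summable_ignore_initial_segment)
      show "summable (\<lambda>m. b (m + N))" using b by (simp add: summable_ignore_initial_segment)
    qed
    also have "\<dots> = suminf b - (\<Sum>m<N. b m)" by (rule suminf_minus_initial_segment[OF b])
    finally show "norm ((trunc (Suc e # es) N - mzv (map Suc (Suc e # es))) * harm N ^ j) \<le> suminf b - (\<Sum>m<N. b m)" .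
  qed
qed

interpretation st: regularized_product
  "\<lambda>u v. harmonic_index (index_of u) (index_of v)" stuffle_list trunc sequentially
proof
  show "harmonic_index (index_of (exp_word es)) (index_of (exp_word es')) = (\<Sum>w\<leftarrow>stuffle_list es es'. word (exp_word w))" for es es'
    by (simp add: harmonic_index_stuffle)
  show "filterlim (trunc [0]) at_top sequentially"
    unfolding trunc_0_harm[abs_def] by (rule harm_at_top)
  show "(\<lambda>N. (trunc (Suc e # es) N - mzv (map Suc (Suc e # es))) * trunc [0] N ^ j) \<longlonglongrightarrow> 0" for e es j
    unfolding trunc_0_harm by (rule trunc_tendsto_mzv)
qed (simp_all add: leading_zeros_stuffle trunc_mult del: replicate_Suc)

lemma zeta_harmonic_eq: "zeta_harmonic (map Suc es) = poly (st.R es) 0"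
  unfolding zeta_harmonic_def harmonic_def st.regularization_zgen ..

section \<open>Polylogarithms and the shuffle type\<close>

text \<open>The coefficients of the multiple polylogarithm
  \<open>\<Sum> t\<^bsup>m\<^sub>1\<^esup> / (m\<^sub>1\<^bsup>l\<^sub>1\<^esup> \<cdots> m\<^sub>n\<^bsup>l\<^sub>n\<^esup>)\<close>. Their partial sums are the truncated multiple zeta values, so the
  polylogarithm is \<open>1 - t\<close> times the generating function of these.\<close>

fun li_coeff :: "nat list \<Rightarrow> nat \<Rightarrow> real" where
  "li_coeff [] m = (if m = 0 then 1 else 0)"
| "li_coeff (e # es) 0 = 0"
| "li_coeff (e # es) (Suc m) = trunc es m / real (Suc m) ^ Suc e"

definition Li :: "nat list \<Rightarrow> real fps" where
  "Li es = Abs_fps (li_coeff es)"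

lemma sum_li_coeff: "(\<Sum>m\<le>N. li_coeff es m) = trunc es N"
proof (cases es)
  case Nil
  then show ?thesis by (induction N) auto
next
  case (Cons e es')
  have "(\<Sum>m<Suc N. li_coeff es m) = trunc es N"
    by (subst sum.lessThan_Suc_shift) (simp add: Cons)
  then show ?thesis by (simp add: lessThan_Suc_atMost)
qed

lemma Li_eq_trunc: "Li es = (1 - fps_X) * Abs_fps (trunc es)"
proof (rule fps_ext)
  fix n
  show "fps_nth (Li es) n = fps_nth ((1 - fps_X) * Abs_fps (trunc es)) n"
  proof (cases n)
    case 0
    then show ?thesis using sum_li_coeff[of es 0] by (simp add: Li_def algebra_simps)
  next
    case (Suc m)
    then show ?thesis using sum_li_coeff[of es "Suc m"] sum_li_coeff[of es m]
      by (simp add: Li_def algebra_simps)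
  qed
qed

text \<open>The derivative of the polylogarithm of a word beginning with \<open>x\<close> (with \<open>y\<close>) is that of the remaining
  word, divided by \<open>t\<close> (by \<open>1 - t\<close>). Multiplying by \<open>t (1 - t)\<close> clears these denominators.\<close>

definition euler_op :: "real fps \<Rightarrow> real fps" where
  "euler_op f = fps_X * (1 - fps_X) * fps_deriv f"

lemma euler_op_add: "euler_op (f + g) = euler_op f + euler_op g"
  by (simp add: euler_op_def algebra_simps)

lemma euler_op_sum_list: "euler_op (\<Sum>x\<leftarrow>A. f x) = (\<Sum>x\<leftarrow>A. euler_op (f x))"
  by (induction A) (auto simp: euler_op_add, simp add: euler_op_def)

lemma euler_op_mult: "euler_op (f * g) = euler_op f * g + f * euler_op g"
  by (simp add: euler_op_def algebra_simps)

lemma euler_op_eq_imp: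
  assumes "euler_op f = euler_op g" "fps_nth f 0 = fps_nth g 0"
  shows "f = g"
proof -
  have "fps_X * (1 - fps_X) \<noteq> (0 :: real fps)"
  proof -
    have "fps_nth (1 - fps_X :: real fps) 0 \<noteq> fps_nth 0 0" by simp
    then have "(1 - fps_X :: real fps) \<noteq> 0" by metis
    then show ?thesis by simp
  qed
  with assms(1) have "fps_deriv f = fps_deriv g" by (simp add: euler_op_def)
  then show ?thesis using assms(2) by (simp add: fps_deriv_eq_iff)
qed

lemma euler_op_Li_0: "euler_op (Li (0 # es)) = fps_X * Li es"
proof -
  have "fps_deriv (Li (0 # es)) = Abs_fps (trunc es)"
    by (rule fps_ext) (simp add: Li_def del: of_nat_Suc)
  then show ?thesis by (simp add: euler_op_def Li_eq_trunc[of es] algebra_simps)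
qed

lemma euler_op_Li_Suc: "euler_op (Li (Suc e # es)) = (1 - fps_X) * Li (e # es)"
proof -
  have "fps_X * fps_deriv (Li (Suc e # es)) = Li (e # es)"
  proof (rule fps_ext)
    fix n
    show "fps_nth (fps_X * fps_deriv (Li (Suc e # es))) n = fps_nth (Li (e # es)) n"
      by (cases n) (simp_all add: Li_def field_simps del: of_nat_Suc)
  qed
  then show ?thesis by (simp add: euler_op_def algebra_simps)
qed

text \<open>The words in \<open>H1\<close>, equivalently those that do not end in \<open>x\<close>.\<close>

definition H1_word :: "letter list \<Rightarrow> bool" where
  "H1_word w \<longleftrightarrow> w \<in> range exp_word"

lemma H1_word_exp_word [simp]: "H1_word (exp_word es)"
  by (simp add: H1_word_def)

lemma H1_word_iff: "H1_word w \<longleftrightarrow> w = [] \<or> last w = Letter_y"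
proof
  assume "H1_word w"
  then obtain es where "w = exp_word es" by (auto simp: H1_word_def)
  then show "w = [] \<or> last w = Letter_y" by (cases es rule: rev_cases) auto
next
  assume "w = [] \<or> last w = Letter_y"
  then show "H1_word w"
  proof (cases w rule: rev_cases)
    case Nil
    then show ?thesis using H1_word_exp_word[of "[]"] by simp
  qed (use snoc_y_in_range H1_word_def in auto)
qed

lemma exp_word_exponents: "H1_word w \<Longrightarrow> exp_word (exponents w) = w"
  by (auto simp: H1_word_def)

lemma H1_word_tl: "H1_word (a # w) \<Longrightarrow> H1_word w"
  by (auto simp: H1_word_iff split: if_splits)

lemma H1_word_shuffle:
  "H1_word u \<Longrightarrow> H1_word v \<Longrightarrow> w \<in> set (shuffle_list u v) \<Longrightarrow> H1_word w"
proof (induction u v arbitrary: w rule: shuffle_list.induct)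
  case (3 a u b v)
  have cons: "H1_word (c # z)" if "H1_word z" "z \<noteq> []" for c z
    using that by (simp add: H1_word_iff)
  have ne: "z \<noteq> []" if "z \<in> set (shuffle_list u (b # v)) \<or> z \<in> set (shuffle_list (a # u) v)" for z
  proof
    assume "z = []"
    with that have "0 = length u + length (b # v) \<or> 0 = length (a # u) + length v"
      using length_shuffle_list by (metis list.size(3))
    then show False by simp
  qed
  from "3.prems"(3) consider z where "w = a # z" "z \<in> set (shuffle_list u (b # v))"
    | z where "w = b # z" "z \<in> set (shuffle_list (a # u) v)"
    unfolding shuffle_list.simps set_append set_map by blast
  then show ?case
  proof cases
    case 1
    then show ?thesis using "3.IH"(1)[OF H1_word_tl[OF "3.prems"(1)] "3.prems"(2) 1(2)] ne cons by simp
  next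
    case 2
    then show ?thesis using "3.IH"(2)[OF "3.prems"(1) H1_word_tl[OF "3.prems"(2)] 2(2)] ne cons by simp
  qed
qed simp_all

definition kernel :: "letter \<Rightarrow> real fps" where
  "kernel a = (case a of Letter_x \<Rightarrow> 1 - fps_X | Letter_y \<Rightarrow> fps_X)"

lemma euler_op_Li_word:
  assumes "H1_word (a # w)"
  shows "euler_op (Li (exponents (a # w))) = kernel a * Li (exponents w)"
    and "fps_nth (Li (exponents (a # w))) 0 = 0"
proof -
  obtain es where es: "a # w = exp_word es" using assms by (auto simp: H1_word_def)
  then obtain e es' where e: "es = e # es'" by (cases es) auto
  show "euler_op (Li (exponents (a # w))) = kernel a * Li (exponents w)"
  proof (cases e)
    case 0
    then have "a = Letter_y" "w = exp_word es'" using es e by auto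
    then show ?thesis using es e 0 by (simp add: euler_op_Li_0 kernel_def del: exp_word_Cons)
  next
    case (Suc e')
    then have "a = Letter_x" "w = exp_word (e' # es')" using es e by auto
    then show ?thesis using es e Suc by (simp add: euler_op_Li_Suc kernel_def del: exp_word_Cons)
  qed
  show "fps_nth (Li (exponents (a # w))) 0 = 0"
    using es e by (simp add: Li_def del: exp_word_Cons)
qed

text \<open>Both sides satisfy the same differential equation, by the product rule, and have the same constant
  term.\<close>

lemma Li_shuffle:
  assumes "H1_word u" "H1_word v"
  shows "Li (exponents u) * Li (exponents v) = (\<Sum>w\<leftarrow>shuffle_list u v. Li (exponents w))"
  using assms
proof (induction u v rule: shuffle_list.induct)
  case (1 v)
  have "Li (exponents []) = 1"
    by (rule fps_ext) (simp add: Li_def exponents_def index_of_def)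
  then show ?case by simp
next
  case (2 a u)
  have "Li (exponents []) = 1"
    by (rule fps_ext) (simp add: Li_def exponents_def index_of_def)
  then show ?case by simp
next
  case (3 a u b v)
  have closed: "H1_word (a # z)" if "z \<in> set (shuffle_list u (b # v))" for z
    using H1_word_shuffle[OF 3(3,4)] that by simp
  have closed': "H1_word (b # z)" if "z \<in> set (shuffle_list (a # u) v)" for z
    using H1_word_shuffle[OF 3(3,4)] that by simp
  show ?case
  proof (rule euler_op_eq_imp)
    have "euler_op (\<Sum>w\<leftarrow>shuffle_list (a # u) (b # v). Li (exponents w))
       = (\<Sum>w\<leftarrow>shuffle_list u (b # v). euler_op (Li (exponents (a # w))))
        + (\<Sum>w\<leftarrow>shuffle_list (a # u) v. euler_op (Li (exponents (b # w))))"
      by (simp add: euler_op_add euler_op_sum_list o_def)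
    also have "(\<Sum>w\<leftarrow>shuffle_list u (b # v). euler_op (Li (exponents (a # w))))
        = (\<Sum>w\<leftarrow>shuffle_list u (b # v). kernel a * Li (exponents w))"
      by (rule arg_cong[of _ _ sum_list], rule map_cong) (use euler_op_Li_word closed in auto)
    also have "(\<Sum>w\<leftarrow>shuffle_list (a # u) v. euler_op (Li (exponents (b # w))))
        = (\<Sum>w\<leftarrow>shuffle_list (a # u) v. kernel b * Li (exponents w))"
      by (rule arg_cong[of _ _ sum_list], rule map_cong) (use euler_op_Li_word closed' in auto)
    also have "(\<Sum>w\<leftarrow>shuffle_list u (b # v). kernel a * Li (exponents w))
         = kernel a * (Li (exponents u) * Li (exponents (b # v)))"
      using 3 H1_word_tl[OF 3(3)] H1_word_tl[OF 3(4)] by (simp add: sum_list_const_mult)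
    also have "(\<Sum>w\<leftarrow>shuffle_list (a # u) v. kernel b * Li (exponents w))
         = kernel b * (Li (exponents (a # u)) * Li (exponents v))"
      using 3 H1_word_tl[OF 3(3)] H1_word_tl[OF 3(4)] by (simp add: sum_list_const_mult)
    finally show "euler_op (Li (exponents (a # u)) * Li (exponents (b # v)))
        = euler_op (\<Sum>w\<leftarrow>shuffle_list (a # u) (b # v). Li (exponents w))"
      using 3 by (simp add: euler_op_mult euler_op_Li_word)
    have zero: "fps_nth (\<Sum>w\<leftarrow>A. g w) 0 = 0" if "\<And>w. w \<in> set A \<Longrightarrow> fps_nth (g w) 0 = 0"
      for A and g :: "letter list \<Rightarrow> real fps" using that by (induction A) auto
    have "fps_nth (\<Sum>w\<leftarrow>shuffle_list (a # u) (b # v). Li (exponents w)) 0 = 0"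
      by (rule zero) (use closed closed' euler_op_Li_word(2) in auto)
    then show "fps_nth (Li (exponents (a # u)) * Li (exponents (b # v))) 0
        = fps_nth (\<Sum>w\<leftarrow>shuffle_list (a # u) (b # v). Li (exponents w)) 0"
      using 3 euler_op_Li_word(2) by simp
  qed
qed

lemma trunc_le_linear: obtains C where "C > 0" "\<And>m. trunc es m \<le> C * real (Suc m)"
proof -
  obtain C where "C > 0" "\<And>m. harm m ^ length es \<le> C * real (Suc m) powr 1"
    using harm_power_bound[of 1] by auto
  then show ?thesis using that trunc_le_harm order_trans by (metis abs_of_nat powr_one' )
qed

lemma summable_trunc:
  assumes "\<bar>t\<bar> < 1"
  shows "summable (\<lambda>N. trunc es N * t ^ N)"
proof -
  obtain C where C: "C > 0" "\<And>m. trunc es m \<le> C * real (Suc m)" using trunc_le_linear by blast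
  show ?thesis
  proof (rule summable_comparison_test)
    show "summable (\<lambda>N. C * (real (Suc N) * \<bar>t\<bar> ^ N))"
      using geometric_deriv_sums[of "\<bar>t\<bar>"] assms by (intro summable_mult) (auto simp: sums_iff)
    have "norm (trunc es N * t ^ N) \<le> C * (real (Suc N) * \<bar>t\<bar> ^ N)" for N
      using mult_right_mono[OF C(2)[of N], of "\<bar>t\<bar> ^ N"] by (simp add: abs_mult power_abs trunc_nonneg mult.assoc)
    then show "\<exists>M. \<forall>N\<ge>M. norm (trunc es N * t ^ N) \<le> C * (real (Suc N) * \<bar>t\<bar> ^ N)" by blast
  qed
qed

lemma conv_radius_trunc: "fps_conv_radius (Abs_fps (trunc es)) \<ge> 1"
  unfolding fps_conv_radius_def
proof (rule conv_radius_geI_ex')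
  fix r :: real assume "0 < r" "ereal r < 1"
  then show "summable (\<lambda>n. fps_nth (Abs_fps (trunc es)) n * of_real r ^ n)"
    using summable_trunc[of r es] by simp
qed

lemma conv_radius_1_minus_X: "fps_conv_radius (1 - fps_X :: real fps) = \<infinity>"
  using fps_conv_radius_diff[of "1 :: real fps" fps_X] by simp

lemma conv_radius_Li: "fps_conv_radius (Li es) \<ge> 1"
proof -
  have "min (fps_conv_radius (1 - fps_X :: real fps)) (fps_conv_radius (Abs_fps (trunc es))) \<ge> 1"
    using conv_radius_trunc by (simp add: conv_radius_1_minus_X)
  then show ?thesis unfolding Li_eq_trunc using fps_conv_radius_mult order_trans by blast
qed

definition li :: "nat list \<Rightarrow> real \<Rightarrow> real" where
  "li es t = eval_fps (Li es) t"

lemma less_conv_radius_Li: "\<bar>t\<bar> < 1 \<Longrightarrow> ereal (norm (t :: real)) < fps_conv_radius (Li es)"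
  by (rule less_le_trans[OF _ conv_radius_Li]) (simp add: one_ereal_def)

lemma li_trunc:
  assumes "\<bar>t\<bar> < 1"
  shows "li es t = (1 - t) * suminf (\<lambda>N. trunc es N * t ^ N)"
proof -
  have "ereal (norm t) < fps_conv_radius (Abs_fps (trunc es))"
    by (rule less_le_trans[OF _ conv_radius_trunc]) (use assms in \<open>simp add: one_ereal_def\<close>)
  then have "li es t = eval_fps (1 - fps_X) t * eval_fps (Abs_fps (trunc es)) t"
    unfolding li_def Li_eq_trunc by (intro eval_fps_mult) (simp_all add: conv_radius_1_minus_X)
  also have "eval_fps (1 - fps_X) t = 1 - t"
    by (subst eval_fps_diff) simp_all
  finally show ?thesis by (simp add: eval_fps_def)
qed

lemma li_Cons_sums:
  assumes "\<bar>t\<bar> < 1"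
  shows "(\<lambda>m. trunc es m / real (Suc m) ^ Suc e * t ^ Suc m) sums li (e # es) t"
proof -
  have "(\<lambda>m. fps_nth (Li (e # es)) m * t ^ m) sums li (e # es) t"
    unfolding li_def by (rule sums_eval_fps) (use less_conv_radius_Li assms in simp)
  then have "(\<lambda>m. fps_nth (Li (e # es)) (Suc m) * t ^ Suc m) sums li (e # es) t"
    by (subst sums_Suc_iff) (simp add: Li_def)
  then show ?thesis by (simp add: Li_def del: of_nat_Suc power_Suc)
qed

lemma li_0: "\<bar>t\<bar> < 1 \<Longrightarrow> li [0] t = - ln (1 - t)"
proof -
  assume t: "\<bar>t\<bar> < 1"
  have "(\<lambda>n. - ((t ^ n) / of_nat n)) sums ln (1 - t)"
    using ln_series'[of "- t"] t by simp
  from sums_minus[OF this] have "(\<lambda>n. t ^ n / of_nat n) sums (- ln (1 - t))" by simp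
  then have "(\<lambda>n. t ^ Suc n / of_nat (Suc n)) sums (- ln (1 - t))"
    by (subst sums_Suc_iff) simp
  moreover have "(\<lambda>n. t ^ Suc n / of_nat (Suc n)) sums li [0] t"
    using li_Cons_sums[OF t, of "[]" 0] by simp
  ultimately show ?thesis using sums_unique2 by blast
qed

text \<open>From Bernoulli's inequality \<open>1 - t\<^sup>k \<le> min 1 (k (1 - t))\<close> and \<open>min 1 x \<le> sqrt x\<close>.\<close>

lemma one_minus_power_le:
  assumes "0 < t" "t < (1::real)"
  shows "1 - t ^ k \<le> sqrt (real k) * sqrt (1 - t)"
proof -
  define x where "x = real k * (1 - t)"
  have x: "x \<ge> 0" using assms by (simp add: x_def)
  have "1 + real k * (t - 1) \<le> (1 + (t - 1)) ^ k" by (rule Bernoulli_inequality) (use assms in simp)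
  then have 1: "1 - t ^ k \<le> x" by (simp add: x_def algebra_simps)
  have 2: "1 - t ^ k \<le> 1" using assms by simp
  have "1 - t ^ k \<le> sqrt x"
  proof (cases "x \<le> 1")
    case True
    then have "x * x \<le> x" using x mult_left_le by blast
    then have "x \<le> sqrt x" using x by (simp add: real_le_rsqrt power2_eq_square)
    with 1 show ?thesis by simp
  next
    case False
    then have "1 \<le> sqrt x" by simp
    with 2 show ?thesis by (rule order_trans)
  qed
  then show ?thesis by (simp add: x_def real_sqrt_mult)
qed

text \<open>A rate of convergence in Abel's limit theorem; a power of \<open>1 - t\<close> beats all powers of
  \<open>li [0] t = - ln (1 - t)\<close>.\<close>

lemma li_tendsto_mzv_bound:
  obtains K where "\<And>t. 0 < t \<Longrightarrow> t < 1 \<Longrightarrow>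
    \<bar>li (Suc e # es) t - mzv (map Suc (Suc e # es))\<bar> \<le> K * sqrt (1 - t)"
proof -
  define a where "a m = trunc es m / real (Suc m) ^ Suc (Suc e)" for m
  obtain C where C: "C > 0" "\<And>m. a m \<le> C * real (Suc m) powr (- 7 / 4)"
    using coefficient_bound[of es e 0] unfolding a_def by (auto simp: mult_1_right)
  have a0: "a m \<ge> 0" for m by (simp add: a_def trunc_nonneg)
  have sa: "a sums mzv (map Suc (Suc e # es))" unfolding a_def by (rule mzv_sums)
  define c where "c m = C * real (Suc m) powr (- 5 / 4)" for m
  have c: "summable c" unfolding c_def by (intro summable_mult summable_Suc_powr) simp
  have "\<bar>li (Suc e # es) t - mzv (map Suc (Suc e # es))\<bar> \<le> suminf c * sqrt (1 - t)" if t: "0 < t" "t < 1" for t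
  proof -
    have "(\<lambda>m. a m * t ^ Suc m) sums li (Suc e # es) t"
      using li_Cons_sums[of t es "Suc e"] t unfolding a_def by simp
    from sums_diff[OF sa this]
    have s: "(\<lambda>m. a m * (1 - t ^ Suc m)) sums (mzv (map Suc (Suc e # es)) - li (Suc e # es) t)"
      by (simp add: algebra_simps)
    have le: "a m * (1 - t ^ Suc m) \<le> c m * sqrt (1 - t)" for m
    proof -
      have "a m * (1 - t ^ Suc m) \<le> (C * real (Suc m) powr (- 7 / 4)) * (sqrt (real (Suc m)) * sqrt (1 - t))"
      proof (rule mult_mono[OF C(2) one_minus_power_le])
        show "0 \<le> C * real (Suc m) powr (- 7 / 4)" using C(1) by simp
        show "0 \<le> 1 - t ^ Suc m" using t power_le_one[of t "Suc m"] by simp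
      qed (use t in auto)
      also have "sqrt (real (Suc m)) = real (Suc m) powr (1 / 2)" by (simp add: powr_half_sqrt)
      also have "C * real (Suc m) powr (- 7 / 4) * (real (Suc m) powr (1 / 2) * sqrt (1 - t)) = c m * sqrt (1 - t)"
        by (simp add: c_def mult.assoc flip: powr_add)
      finally show ?thesis .
    qed
    have "mzv (map Suc (Suc e # es)) - li (Suc e # es) t \<le> suminf c * sqrt (1 - t)"
    proof (rule sums_le[OF le s])
      show "(\<lambda>m. c m * sqrt (1 - t)) sums (suminf c * sqrt (1 - t))"
        by (intro sums_mult2 summable_sums c)
    qed
    moreover have "0 \<le> a m * (1 - t ^ Suc m)" for m
      using a0 t power_le_one[of t "Suc m"] by (intro mult_nonneg_nonneg) auto
    then have "0 \<le> mzv (map Suc (Suc e # es)) - li (Suc e # es) t"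
      using sums_le[OF _ sums_zero s] by simp
    ultimately show ?thesis by simp
  qed
  then show ?thesis using that by blast
qed

lemma eventually_01: "\<forall>\<^sub>F t in at_left (1::real). 0 < t \<and> t < 1"
  using eventually_at_left_real[of 0 1] by (auto elim: eventually_mono)

lemma li_tendsto_mzv:
  "((\<lambda>t. (li (Suc e # es) t - mzv (map Suc (Suc e # es))) * li [0] t ^ j) \<longlongrightarrow> 0) (at_left 1)"
proof -
  obtain K where K: "\<And>t. 0 < t \<Longrightarrow> t < 1 \<Longrightarrow>
    \<bar>li (Suc e # es) t - mzv (map Suc (Suc e # es))\<bar> \<le> K * sqrt (1 - t)"
    using li_tendsto_mzv_bound by blast
  obtain C where C: "C > 0" "\<And>x::real. x \<ge> 1 \<Longrightarrow> (1 + ln x) ^ j \<le> C * x powr (1 / 4)"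
    using ln_power_bound[of "1 / 4"] by auto
  have K0: "K \<ge> 0"
  proof -
    have "0 \<le> K * sqrt (1 - 1 / 2)" using K[of "1 / 2"] by (rule order_trans[OF abs_ge_zero]) auto
    then show ?thesis by (simp add: zero_le_mult_iff)
  qed
  show ?thesis
  proof (rule Lim_null_comparison)
    show "\<forall>\<^sub>F t in at_left 1. norm ((li (Suc e # es) t - mzv (map Suc (Suc e # es))) * li [0] t ^ j)
            \<le> K * C * (1 - t) powr (1 / 4)"
      using eventually_01
    proof eventually_elim
      case (elim t)
      then have t: "0 < t" "t < 1" by auto
      define u where "u = 1 - t"
      have u: "0 < u" "u < 1" using t by (auto simp: u_def)
      have L: "li [0] t = ln (1 / u)" using t by (simp add: li_0 u_def ln_div)
      have "\<bar>li [0] t\<bar> ^ j \<le> (1 + ln (1 / u)) ^ j"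
        unfolding L using u by (intro power_mono) (auto simp: ln_div)
      also have "\<dots> \<le> C * (1 / u) powr (1 / 4)" by (rule C) (use u in simp)
      also have "(1 / u) powr (1 / 4) = u powr (- 1 / 4)"
        using u by (simp add: powr_divide powr_minus_divide)
      finally have "\<bar>li [0] t\<bar> ^ j \<le> C * u powr (- 1 / 4)" .
      moreover have "\<bar>li (Suc e # es) t - mzv (map Suc (Suc e # es))\<bar> \<le> K * u powr (1 / 2)"
        using K[OF t] u by (simp add: u_def powr_half_sqrt)
      ultimately have "\<bar>li (Suc e # es) t - mzv (map Suc (Suc e # es))\<bar> * \<bar>li [0] t\<bar> ^ j
          \<le> (K * u powr (1 / 2)) * (C * u powr (- 1 / 4))"
        using K0 by (intro mult_mono) auto
      also have "\<dots> = K * C * (u powr (1 / 2) * u powr (- 1 / 4))" by simp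
      also have "u powr (1 / 2) * u powr (- 1 / 4) = u powr (1 / 4)" by (simp flip: powr_add)
      finally show ?case by (simp add: abs_mult power_abs u_def)
    qed
    have "((\<lambda>t::real. K * C * (1 - t) powr (1 / 4)) \<longlongrightarrow> K * C * 0) (at_left 1)"
    proof (intro tendsto_mult_left)
      have "((\<lambda>t::real. 1 - t) \<longlongrightarrow> 1 - 1) (at_left 1)" by (intro tendsto_intros)
      then show "((\<lambda>t::real. (1 - t) powr (1 / 4)) \<longlongrightarrow> 0) (at_left 1)"
        by (intro tendsto_zero_powrI[of _ _ _ "1 / 4"]) (auto simp: eventually_at_filter intro!: always_eventually)
    qed
    then show "((\<lambda>t::real. K * C * (1 - t) powr (1 / 4)) \<longlongrightarrow> 0) (at_left 1)" by simp
  qed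
qed

lemma li_0_at_top: "filterlim (li [0]) at_top (at_left 1)"
proof -
  have "filterlim (\<lambda>t::real. 1 - t) (at_right 0) (at_left 1)"
    unfolding filterlim_at
  proof
    show "\<forall>\<^sub>F t in at_left 1. 1 - t \<in> {0<..} \<and> 1 - t \<noteq> (0::real)"
      using eventually_01 by eventually_elim auto
    have "((\<lambda>t::real. 1 - t) \<longlongrightarrow> 1 - 1) (at_left 1)" by (intro tendsto_intros)
    then show "((\<lambda>t::real. 1 - t) \<longlongrightarrow> 0) (at_left 1)" by simp
  qed
  from filterlim_compose[OF ln_at_0 this]
  have "filterlim (\<lambda>t::real. - ln (1 - t)) at_top (at_left 1)"
    by (simp add: filterlim_uminus_at_top)
  moreover have "\<forall>\<^sub>F t in at_left 1. - ln (1 - t) = li [0] t"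
    using eventually_01 by eventually_elim (simp add: li_0)
  ultimately show ?thesis by (rule filterlim_cong[OF refl refl, THEN iffD1, rotated])
qed

text \<open>The shuffle product on words of \<open>H1\<close>, transported to exponent lists.\<close>

definition shuffle_exponents :: "nat list \<Rightarrow> nat list \<Rightarrow> nat list list" where
  "shuffle_exponents es es' = map exponents (shuffle_list (exp_word es) (exp_word es'))"

lemma shuffle_word_eq: "shuffle_word u v = (\<Sum>w\<leftarrow>shuffle_list u v. word w)"
proof (induction u v rule: shuffle_word.induct)
  case (3 a u b v)
  have "word [a] * (\<Sum>w\<leftarrow>ws. word w) = (\<Sum>w\<leftarrow>ws. word (a # w))" for a ws
    by (simp add: sum_list_const_mult[symmetric] flip: word_append)
  then show ?case using 3 by (simp add: o_def)
qed auto

lemma exponents_y_Cons [simp]: "exponents (Letter_y # w) = 0 # exponents w"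
  by (simp add: exponents_def index_of_def)

lemma leading_zeros_x_Cons [simp]: "leading_zeros (exponents (Letter_x # w)) = 0"
proof -
  have "index_aux (Suc j) w = [] \<or> hd (index_aux (Suc j) w) > Suc j" for j
  proof (induction w arbitrary: j)
    case (Cons a w)
    then show ?case using Cons.IH[of "Suc j"] by (cases a) fastforce+
  qed auto
  from this[of 0] show ?thesis
    by (cases "index_aux (Suc 0) w") (auto simp: leading_zeros_eq_0 exponents_def index_of_def)
qed

lemma leading_zeros_shuffle:
  "filter (\<lambda>v. leading_zeros es < leading_zeros v) (shuffle_exponents [0] es)
     = replicate (Suc (leading_zeros es)) (0 # es)"
proof (induction es)
  case Nil
  then show ?case by (simp add: shuffle_exponents_def exponents_def index_of_def)
next
  case (Cons e es)
  show ?case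
  proof (cases e)
    case 0
    have "shuffle_exponents [0] (0 # es) = (0 # 0 # es) # map ((#) 0) (shuffle_exponents [0] es)"
      by (simp add: shuffle_exponents_def o_def)
    then show ?thesis using Cons 0 by (simp add: filter_map o_def map_replicate)
  next
    case (Suc e')
    have "shuffle_exponents [0] (Suc e' # es) = (0 # Suc e' # es) #
        map (\<lambda>w. exponents (Letter_x # w)) (shuffle_list [Letter_y] (exp_word (e' # es)))"
      using exponents_exp_word'[of "Suc e' # es"] by (simp add: shuffle_exponents_def o_def)
    then show ?thesis using Suc by (simp add: filter_map o_def)
  qed
qed

lemma exp_word_shuffle_exponents:
  "map exp_word (shuffle_exponents es es') = shuffle_list (exp_word es) (exp_word es')"
  unfolding shuffle_exponents_def map_map
  by (rule map_idI) (use H1_word_shuffle[OF H1_word_exp_word H1_word_exp_word] exp_word_exponents in auto)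

lemma li_mult:
  assumes "\<bar>t\<bar> < 1"
  shows "li es t * li es' t = (\<Sum>w\<leftarrow>shuffle_exponents es es'. li w t)"
proof -
  have sum: "eval_fps (\<Sum>w\<leftarrow>ws. Li w) t = (\<Sum>w\<leftarrow>ws. li w t) \<and>
      ereal (norm t) < fps_conv_radius (\<Sum>w\<leftarrow>ws. Li w)" for ws
  proof (induction ws)
    case (Cons w ws)
    have "min (fps_conv_radius (Li w)) (fps_conv_radius (\<Sum>w\<leftarrow>ws. Li w)) \<le> fps_conv_radius (Li w + (\<Sum>w\<leftarrow>ws. Li w))"
      by (rule fps_conv_radius_add)
    then have "ereal (norm t) < fps_conv_radius (Li w + (\<Sum>w\<leftarrow>ws. Li w))"
      using Cons less_conv_radius_Li[OF assms, of w] by (meson less_le_trans min_less_iff_conj)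
    then show ?case using Cons less_conv_radius_Li[OF assms, of w] by (simp add: eval_fps_add li_def)
  qed simp
  have "li es t * li es' t = eval_fps (Li es * Li es') t"
    unfolding li_def using less_conv_radius_Li[OF assms] by (simp add: eval_fps_mult)
  also have "Li es * Li es' = (\<Sum>w\<leftarrow>shuffle_exponents es es'. Li w)"
    using Li_shuffle[of "exp_word es" "exp_word es'"] by (simp add: shuffle_exponents_def o_def)
  finally show ?thesis using sum by simp
qed

lemma li_Nil [simp]: "li [] t = 1"
proof -
  have "Li [] = 1" by (rule fps_ext) (simp add: Li_def)
  then show ?thesis by (simp add: li_def)
qed

interpretation sh: regularized_product shuffle_word shuffle_exponents li "at_left 1"
proof
  fix es es' :: "nat list" and e j :: nat and t :: real
  have "(\<Sum>w\<leftarrow>shuffle_list (exp_word es) (exp_word es'). word w)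
      = (\<Sum>w\<leftarrow>shuffle_exponents es es'. word (exp_word w))"
    unfolding exp_word_shuffle_exponents[symmetric] by (simp add: o_def)
  then show "shuffle_word (exp_word es) (exp_word es') = (\<Sum>w\<leftarrow>shuffle_exponents es es'. word (exp_word w))"
    unfolding shuffle_word_eq .
  show "filter (\<lambda>v. leading_zeros es < leading_zeros v) (shuffle_exponents [0] es)
     = replicate (Suc (leading_zeros es)) (0 # es)" by (rule leading_zeros_shuffle)
  show "\<forall>\<^sub>F t in at_left 1. li es t * li es' t = (\<Sum>w\<leftarrow>shuffle_exponents es es'. li w t)"
    using eventually_01 by eventually_elim (simp add: li_mult)
  show "li [] t = 1" by simp
  show "filterlim (li [0]) at_top (at_left 1)" by (rule li_0_at_top)
  show "at_left (1::real) \<noteq> bot" by (simp add: trivial_limit_at_left_real)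
  show "((\<lambda>t. (li (Suc e # es) t - mzv (map Suc (Suc e # es))) * li [0] t ^ j) \<longlongrightarrow> 0) (at_left 1)"
    by (rule li_tendsto_mzv)
qed

lemma zeta_shuffle_eq: "zeta_shuffle (map Suc es) = poly (sh.R es) 0"
  unfolding zeta_shuffle_def shuffle_def sh.regularization_zgen ..

section \<open>Comparison of the two types\<close>

text \<open>Abel summation is regular: the weights \<open>(1 - t) t\<^sup>N\<close> are positive with sum \<open>1\<close>, and each of them tends
  to \<open>0\<close>.\<close>

lemma abel_mean_tendsto_0:
  fixes s :: "nat \<Rightarrow> real"
  assumes "s \<longlonglongrightarrow> 0"
  shows "((\<lambda>t. (1 - t) * suminf (\<lambda>N. s N * t ^ N)) \<longlongrightarrow> 0) (at_left 1)"
proof (rule tendstoI)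
  fix \<epsilon> :: real assume \<epsilon>: "\<epsilon> > 0"
  then obtain N0 where N0: "\<And>N. N \<ge> N0 \<Longrightarrow> \<bar>s N\<bar> < \<epsilon> / 2"
    using LIMSEQ_D[OF assms, of "\<epsilon> / 2"] by auto
  define c where "c = (\<Sum>N<N0. \<bar>s N\<bar>)"
  have "((\<lambda>t. (1 - t) * c) \<longlongrightarrow> (1 - 1) * c) (at_left (1::real))" by (intro tendsto_intros)
  then have "\<forall>\<^sub>F t in at_left (1::real). (1 - t) * c < \<epsilon> / 2"
    using \<epsilon> by (intro order_tendstoD(2)) auto
  then show "\<forall>\<^sub>F t in at_left 1. dist ((1 - t) * suminf (\<lambda>N. s N * t ^ N)) 0 < \<epsilon>"
    using eventually_01
  proof eventually_elim
    case (elim t)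
    define g where "g N = (if N < N0 then \<bar>s N\<bar> else 0) + \<epsilon> / 2 * t ^ N" for N
    have "(\<lambda>N. if N < N0 then \<bar>s N\<bar> else 0) sums c"
      using sums_If_finite_set[of "{..<N0}" "\<lambda>N. \<bar>s N\<bar>"] by (simp add: c_def)
    moreover have "(\<lambda>N. \<epsilon> / 2 * t ^ N) sums (\<epsilon> / 2 * (1 / (1 - t)))"
      using elim by (intro sums_mult geometric_sums) simp
    ultimately have g: "g sums (c + \<epsilon> / 2 * (1 / (1 - t)))"
      unfolding g_def by (rule sums_add)
    have "norm (s N * t ^ N) \<le> g N" for N
    proof (cases "N < N0")
      case True
      have "\<bar>s N\<bar> * t ^ N \<le> \<bar>s N\<bar> * 1"
        using elim power_le_one[of t N] by (intro mult_left_mono) auto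
      moreover have "0 \<le> \<epsilon> / 2 * t ^ N" using \<epsilon> elim by simp
      ultimately show ?thesis using True elim by (simp add: g_def abs_mult)
    next
      case False
      then show ?thesis using N0[of N] elim
        by (simp add: g_def abs_mult mult_right_mono)
    qed
    then have "norm (suminf (\<lambda>N. s N * t ^ N)) \<le> suminf g"
      using g by (intro norm_suminf_le) (auto simp: sums_iff)
    then have "(1 - t) * \<bar>suminf (\<lambda>N. s N * t ^ N)\<bar> \<le> (1 - t) * (c + \<epsilon> / 2 * (1 / (1 - t)))"
      using elim g by (intro mult_left_mono) (auto simp: sums_iff)
    also have "\<dots> = (1 - t) * c + \<epsilon> / 2" using elim by (simp add: field_simps)
    also have "\<dots> < \<epsilon>" using elim by simp
    finally show ?case using elim by (simp add: abs_mult)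
  qed
qed

lemma trunc_power_sums:
  assumes "\<bar>t\<bar> < 1"
  shows "(\<lambda>N. trunc es N * t ^ N) sums (li es t / (1 - t))"
proof -
  have "li es t / (1 - t) = suminf (\<lambda>N. trunc es N * t ^ N)"
    using assms li_trunc[OF assms, of es] by auto
  then show ?thesis using summable_sums[OF summable_trunc[OF assms]] by simp
qed

text \<open>The terms of the \<open>k\<close>-th harmonic power of \<open>y\<close>, which correspond to \<open>harm N ^ k\<close>.\<close>

fun stuffle_power :: "nat \<Rightarrow> nat list list" where
  "stuffle_power 0 = [[]]"
| "stuffle_power (Suc k) = concat (map (stuffle_list [0]) (stuffle_power k))"

lemma sum_list_concat_map:
  fixes f :: "'a \<Rightarrow> 'b :: comm_monoid_add"
  shows "(\<Sum>v\<leftarrow>concat (map g ws). f v) = (\<Sum>w\<leftarrow>ws. \<Sum>v\<leftarrow>g w. f v)"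
  by (induction ws) auto

lemma trunc_stuffle_power: "(\<Sum>v\<leftarrow>stuffle_power k. trunc v N) = trunc [0] N ^ k"
proof (induction k)
  case (Suc k)
  have "(\<Sum>v\<leftarrow>stuffle_power (Suc k). trunc v N)
      = (\<Sum>w\<leftarrow>stuffle_power k. trunc [0] N * trunc w N)"
    unfolding stuffle_power.simps sum_list_concat_map trunc_mult ..
  then show ?case by (simp only: sum_list_const_mult Suc power_Suc)
qed simp

text \<open>Comparison of the regularizations. Replacing each power of \<open>harm N\<close> in the asymptotic expansion of
  the truncated sum by a combination of truncated sums, one gets an identity up to an error tending to \<open>0\<close>;
  taking Abel means turns truncated sums into polylogarithms. Hence the shuffle polynomial is obtained from the
  harmonic one by substituting for the \<open>k\<close>-th power of the variable the shuffle polynomial of the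
  \<open>k\<close>-th harmonic power of \<open>y\<close>.\<close>

lemma sh_R_eq:
  "sh.R es = (\<Sum>k\<le>degree (st.R es). smult (coeff (st.R es) k) (\<Sum>v\<leftarrow>stuffle_power k. sh.R v))"
    (is "_ = ?P")
proof (rule sh.R_eqI)
  let ?p = "st.R es"
  define f where "f t = (\<Sum>k\<le>degree ?p. coeff ?p k * (\<Sum>v\<leftarrow>stuffle_power k. li v t))" for t
  define s where "s N = trunc es N - poly ?p (trunc [0] N)" for N
  have "s \<longlonglongrightarrow> 0"
    using asymp_poly_tendsto[OF st.asymp_R[of es]] by (simp add: s_def[abs_def])
  note lim = abel_mean_tendsto_0[OF this]
  have sums: "(\<lambda>N. s N * t ^ N) sums ((li es t - f t) / (1 - t))" if t: "\<bar>t\<bar> < 1" for t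
  proof -
    have 1: "(\<lambda>N. (\<Sum>v\<leftarrow>vs. trunc v N) * t ^ N) sums ((\<Sum>v\<leftarrow>vs. li v t) / (1 - t))" for vs
    proof (induction vs)
      case (Cons v vs)
      show ?case using sums_add[OF trunc_power_sums[OF t, of v] Cons]
        by (simp add: algebra_simps add_divide_distrib)
    qed simp
    have "(\<lambda>N. \<Sum>k\<le>degree ?p. coeff ?p k * ((\<Sum>v\<leftarrow>stuffle_power k. trunc v N) * t ^ N))
       sums (\<Sum>k\<le>degree ?p. coeff ?p k * ((\<Sum>v\<leftarrow>stuffle_power k. li v t) / (1 - t)))"
      by (intro sums_sum sums_mult 1)
    then have "(\<lambda>N. poly ?p (trunc [0] N) * t ^ N) sums (f t / (1 - t))"
      by (simp only: trunc_stuffle_power poly_altdef f_def sum_distrib_right sum_divide_distrib mult.assoc times_divide_eq_right)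
    from sums_diff[OF trunc_power_sums[OF t, of es] this] show ?thesis
      by (simp add: s_def algebra_simps diff_divide_distrib)
  qed
  have "\<forall>\<^sub>F t in at_left 1. (1 - t) * suminf (\<lambda>N. s N * t ^ N) = li es t - f t"
    using eventually_01
  proof eventually_elim
    case (elim t)
    then have "suminf (\<lambda>N. s N * t ^ N) = (li es t - f t) / (1 - t)"
      by (intro sums_unique[symmetric] sums) simp
    then show ?case using elim by simp
  qed
  then have 1: "((\<lambda>t. li es t - f t) \<longlongrightarrow> 0) (at_left 1)"
    by (rule Lim_transform_eventually[OF lim])
  have "asymp_poly (at_left 1) (li [0]) f ?P"
    unfolding f_def by (intro asymp_poly_sum asymp_poly_cmult asymp_poly_sum_list sh.asymp_R)
  from tendsto_add[OF 1 asymp_poly_tendsto[OF this]]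
  show "((\<lambda>t. li es t - poly ?P (li [0] t)) \<longlongrightarrow> 0) (at_left 1)" by simp
qed

section \<open>Weight and depth\<close>

definition weight :: "nat list \<Rightarrow> nat" where
  "weight es = sum_list es + length es"

lemma weight_simps [simp]: "weight [] = 0" "weight (e # es) = Suc (e + weight es)"
  by (auto simp: weight_def)

lemma weight_eq_0_iff [simp]: "weight es = 0 \<longleftrightarrow> es = []"
  by (auto simp: weight_def)

lemma stuffle_weight: "v \<in> set (stuffle_list u w) \<Longrightarrow> weight v = weight u + weight w"
  by (induction u w arbitrary: v rule: stuffle_list.induct) auto

lemma stuffle_sum: "v \<in> set (stuffle_list u w) \<Longrightarrow> sum_list u + sum_list w \<le> sum_list v"
  by (induction u w arbitrary: v rule: stuffle_list.induct) fastforce+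

lemma stuffle_length: "v \<in> set (stuffle_list u w) \<Longrightarrow> length u \<le> length v \<and> length w \<le> length v"
  by (induction u w arbitrary: v rule: stuffle_list.induct) fastforce+

lemma stuffle_length_le: "v \<in> set (stuffle_list u w) \<Longrightarrow> length v \<le> length u + length w"
  using stuffle_weight[of v u w] stuffle_sum[of v u w] by (simp add: weight_def)

lemma stuffle_power_weight: "v \<in> set (stuffle_power k) \<Longrightarrow> weight v = k"
  by (induction k arbitrary: v) (auto dest: stuffle_weight)

lemma leading_zeros_pure: "sum_list es = 0 \<Longrightarrow> leading_zeros es = length es"
  by (induction es rule: leading_zeros.induct) auto

lemma leading_zeros_le: "leading_zeros es \<le> length es"
  by (induction es rule: leading_zeros.induct) auto

lemma shuffle_exponents_word:
  assumes "v \<in> set (shuffle_exponents es es')"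
  shows "exp_word v \<in> set (shuffle_list (exp_word es) (exp_word es'))"
  using assms exp_word_shuffle_exponents[of es es'] by (metis image_eqI set_map)

lemma shuffle_exponents_weight: "v \<in> set (shuffle_exponents es es') \<Longrightarrow> weight v = weight es + weight es'"
  by (drule shuffle_exponents_word, drule length_shuffle_list) (simp add: weight_def)

lemma shuffle_exponents_length: "v \<in> set (shuffle_exponents es es') \<Longrightarrow> length v = length es + length es'"
proof -
  have count: "count (mset (exp_word es)) Letter_y = length es" for es
  proof (induction es)
    case (Cons e es)
    have "Letter_y \<notin># mset (x_run e)" by simp
    then have "count (mset (x_run e)) Letter_y = 0" by (simp only: not_in_iff)
    then show ?case using Cons by simp
  qed simp
  assume "v \<in> set (shuffle_exponents es es')"
  then have "mset (exp_word v) = mset (exp_word es) + mset (exp_word es')"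
    by (intro mset_shuffle_list shuffle_exponents_word)
  then have "count (mset (exp_word v)) Letter_y = count (mset (exp_word es) + mset (exp_word es')) Letter_y" by simp
  then show ?thesis by (simp add: count)
qed

section \<open>Values of the regularizations\<close>

text \<open>The span of all multiple zeta values of a given weight, of whatever depth. Products of two elements
  of positive weight lie in \<^const>\<open>Pspace\<close>.\<close>

definition Wspace :: "nat \<Rightarrow> real set" where
  "Wspace l = rat_real.span {mzv ks | ks. admissible ks \<and> sum_list ks = l}"

lemma subspace_Wspace: "rat_subspace (Wspace l)"
  and subspace_Zspace: "rat_subspace (Zspace l d)"
  and subspace_Pspace: "rat_subspace (Pspace l)"
  by (simp_all add: rat_subspace_def Wspace_def Zspace_def Pspace_def rat_real.subspace_span)

lemma Zspace_subset_Wspace: "Zspace l d \<subseteq> Wspace l"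
  unfolding Wspace_def Zspace_def by (intro rat_real.span_mono) auto

lemma Wspace_mult:
  assumes "x \<in> Wspace a" "y \<in> Wspace b"
  shows "x * y \<in> Pspace (a + b)"
proof -
  interpret P: rat_subspace "Pspace (a + b)" by (rule subspace_Pspace)
  have gen: "mzv ks * mzv ks' \<in> Pspace (a + b)"
    if "admissible ks" "sum_list ks = a" "admissible ks'" "sum_list ks' = b" for ks ks'
    unfolding Pspace_def
    by (intro rat_real.span_base UnI1 CollectI exI[of _ "[ks, ks']"]) (use that in auto)
  have right: "mzv ks * y \<in> Pspace (a + b)" if "admissible ks" "sum_list ks = a" for ks
    using assms(2) unfolding Wspace_def
  proof (induction rule: rat_real.span_induct_alt)
    case (step c x y)
    then obtain ks' where "x = mzv ks'" "admissible ks'" "sum_list ks' = b" by blast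
    then have "of_rat c * (mzv ks * x) + mzv ks * y \<in> Pspace (a + b)"
      using gen that step by (intro P.add_mem P.scale_mem) auto
    then show ?case by (simp add: algebra_simps)
  qed simp
  show ?thesis
    using assms(1) unfolding Wspace_def
  proof (induction rule: rat_real.span_induct_alt)
    case (step c x z)
    then obtain ks where "x = mzv ks" "admissible ks" "sum_list ks = a" by blast
    then have "of_rat c * (x * y) + z * y \<in> Pspace (a + b)"
      using right step by (intro P.add_mem P.scale_mem) auto
    then show ?case by (simp add: algebra_simps)
  qed simp
qed

lemma mzv_mem_Zspace: "mzv (map Suc (Suc e # es)) \<in> Zspace (weight (Suc e # es)) (length (Suc e # es))"
  unfolding Zspace_def
proof (rule rat_real.span_base, rule CollectI, intro exI conjI)
  show "admissible (map Suc (Suc e # es))" by (simp add: admissible_def)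
  have "sum_list (map Suc es) = weight es" for es by (induction es) auto
  then show "sum_list (map Suc (Suc e # es)) = weight (Suc e # es)" .
qed auto

abbreviation zst :: "nat list \<Rightarrow> real" where "zst es \<equiv> poly (st.R es) 0"
abbreviation zsh :: "nat list \<Rightarrow> real" where "zsh es \<equiv> poly (sh.R es) 0"

context regularized_product
begin

lemma R_0_recursion:
  "of_nat (Suc (leading_zeros es)) * R (0 # es) = [:0, 1:] * R es - (\<Sum>w\<leftarrow>lower_terms es. R w)"
  using sum_list_prodl_0[of R es] by (simp del: of_nat_Suc flip: R_mult)

text \<open>The polynomial of \<open>y\<close> has constant term \<open>0\<close>; hence no products occur, and spans of values are
  preserved.\<close>

lemma value_0_recursion:
  "of_nat (Suc (leading_zeros es)) * poly (R (0 # es)) 0 = - (\<Sum>w\<leftarrow>lower_terms es. poly (R w) 0)"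
proof -
  have "poly (of_nat (Suc (leading_zeros es)) * R (0 # es)) 0 = - poly (\<Sum>w\<leftarrow>lower_terms es. R w) 0"
    unfolding R_0_recursion by simp
  moreover have "poly (\<Sum>w\<leftarrow>ws. R w) 0 = (\<Sum>w\<leftarrow>ws. poly (R w) 0)" for ws by (induction ws) auto
  ultimately show ?thesis by (simp del: of_nat_Suc)
qed

lemma coeff_0_recursion:
  "of_nat (Suc (leading_zeros es)) * coeff (R (0 # es)) j
     = (case j of 0 \<Rightarrow> 0 | Suc i \<Rightarrow> coeff (R es) i) - (\<Sum>w\<leftarrow>lower_terms es. coeff (R w) j)"
proof -
  have "coeff (of_nat (Suc (leading_zeros es)) * R (0 # es)) j
     = coeff ([:0, 1:] * R es) j - coeff (\<Sum>w\<leftarrow>lower_terms es. R w) j"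
    unfolding R_0_recursion by simp
  moreover have "coeff (\<Sum>w\<leftarrow>ws. R w) j = (\<Sum>w\<leftarrow>ws. coeff (R w) j)" for ws by (induction ws) auto
  moreover have "coeff (of_nat k * p) j = of_nat k * coeff p j" for k and p :: "real poly"
    by (simp add: of_nat_poly)
  ultimately show ?thesis by (simp add: coeff_pCons del: of_nat_Suc)
qed

lemma lower_termsD: "v \<in> set (lower_terms es) \<Longrightarrow> v \<in> set (prodl [0] es)"
  by (simp add: lower_terms_def)

lemma value_mult: "poly (R es) 0 * poly (R es') 0 = (\<Sum>w\<leftarrow>prodl es es'. poly (R w) 0)"
proof -
  have "poly (\<Sum>w\<leftarrow>ws. R w) 0 = (\<Sum>w\<leftarrow>ws. poly (R w) 0)" for ws by (induction ws) auto
  then show ?thesis by (simp only: R_mult flip: poly_mult)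
qed

end

text \<open>Shuffle products preserve the depth, so shuffle regularized values of depth \<open>d\<close> are combinations of
  convergent values of exactly that depth. The harmonic product mixes depths.\<close>

lemma zsh_mem_Zspace: "es \<noteq> [] \<Longrightarrow> zsh es \<in> Zspace (weight es) (length es)"
proof (induction es rule: sh.leading_zeros_induct)
  case (adm es)
  then obtain e es' where "es = Suc e # es'" by (cases es rule: leading_zeros.cases) auto
  then show ?case using mzv_mem_Zspace[of e es'] by (simp only: sh.R_adm) simp
next
  case (step es)
  interpret Z: rat_subspace "Zspace (weight (0 # es)) (length (0 # es))" by (rule subspace_Zspace)
  have "zsh v \<in> Zspace (weight (0 # es)) (length (0 # es))" if "v \<in> set (sh.lower_terms es)" for v
  proof -
    have "v \<in> set (shuffle_exponents [0] es)" using that by (rule sh.lower_termsD)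
    then have "weight v = weight (0 # es)" "length v = length (0 # es)"
      by (auto dest: shuffle_exponents_weight shuffle_exponents_length)
    moreover from this have "v \<noteq> []" by auto
    ultimately show ?thesis using step.IH(2)[OF that] by simp
  qed
  then have "of_nat (Suc (leading_zeros es)) * zsh (0 # es) \<in> Zspace (weight (0 # es)) (length (0 # es))"
    unfolding sh.value_0_recursion by (intro Z.minus_mem Z.sum_list_mem)
  then show ?case by (rule Z.of_nat_cancel)
qed

text \<open>The shuffle power of \<open>y\<close> is a multiple of the word \<open>y \<cdots> y\<close>, and \<open>y\<close> has value \<open>0\<close>.\<close>

lemma zsh_pure:
  assumes "sum_list es = 0" "es \<noteq> []"
  shows "zsh es = 0"
proof -
  obtain es' where es: "es = 0 # es'" using assms by (cases es) auto
  have "sh.lower_terms es' = []"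
  proof (rule ccontr)
    assume "sh.lower_terms es' \<noteq> []"
    then obtain v where v: "v \<in> set (sh.lower_terms es')" by (meson list.set_sel(1))
    then have "v \<in> set (shuffle_exponents [0] es')" by (rule sh.lower_termsD)
    then have "weight v = weight es" "length v = length es"
      using es by (auto dest: shuffle_exponents_weight shuffle_exponents_length)
    then have "leading_zeros v = length es" using assms leading_zeros_pure[of v] by (simp add: weight_def)
    then show False using v es leading_zeros_le[of es'] by (auto simp: sh.lower_terms_def)
  qed
  then have "of_nat (Suc (leading_zeros es')) * zsh (0 # es') = 0"
    unfolding sh.value_0_recursion by simp
  then show ?thesis using es by simp
qed

text \<open>The words other than powers of \<open>y\<close> are those with a positive exponent. They are separated from the powers of
  \<open>y\<close> because the harmonic product never decreases the sum of the exponents.\<close>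

lemma st_lower_terms_nonpure:
  assumes "v \<in> set (st.lower_terms es)"
  shows "0 < sum_list v" "weight v = weight (0 # es)" "length es \<le> length v"
proof -
  have v: "v \<in> set (stuffle_list [0] es)" using assms by (rule st.lower_termsD)
  then show w: "weight v = weight (0 # es)" "length es \<le> length v"
    by (auto dest: stuffle_weight stuffle_length)
  show "0 < sum_list v"
  proof (rule ccontr)
    assume "\<not> 0 < sum_list v"
    then have v0: "sum_list v = 0" by linarith
    then have "leading_zeros v = weight v" "sum_list es = 0"
      using leading_zeros_pure[OF v0] stuffle_sum[OF v] by (simp add: weight_def, linarith)
    then show False using assms w leading_zeros_le[of es] by (auto simp: st.lower_terms_def weight_def)
  qed
qed

text \<open>The variable has weight one: the coefficient of its \<open>j\<close>-th power is a combination of values of weight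
  \<open>weight es - j\<close>. A rational constant as leading coefficient can occur for powers of \<open>y\<close> only, which are
  therefore excluded.\<close>

lemma coeff_st_R:
  assumes "0 < sum_list es"
  shows "(\<forall>j<weight es. coeff (st.R es) j \<in> Wspace (weight es - j)) \<and> (\<forall>j\<ge>weight es. coeff (st.R es) j = 0)"
  using assms
proof (induction es rule: st.leading_zeros_induct)
  case (adm es)
  then obtain e es' where es: "es = Suc e # es'" by (cases es rule: leading_zeros.cases) auto
  interpret W: rat_subspace "Wspace l" for l by (rule subspace_Wspace)
  have "mzv (map Suc (Suc e # es')) \<in> Wspace (weight es)"
    using mzv_mem_Zspace[of e es'] Zspace_subset_Wspace es by blast
  then show ?case unfolding es st.R_adm by (auto simp: coeff_pCons split: nat.splits)
next
  case (step es)
  interpret W: rat_subspace "Wspace l" for l by (rule subspace_Wspace)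
  note low = st_lower_terms_nonpure
  have IH: "(\<forall>j<weight es. coeff (st.R es) j \<in> Wspace (weight es - j)) \<and> (\<forall>j\<ge>weight es. coeff (st.R es) j = 0)"
    using step by simp
  have IHl: "(\<forall>j<weight (0 # es). coeff (st.R v) j \<in> Wspace (weight (0 # es) - j)) \<and> (\<forall>j\<ge>weight (0 # es). coeff (st.R v) j = 0)"
    if "v \<in> set (st.lower_terms es)" for v
    using step.IH(2)[OF that] low[OF that] by simp
  show ?case
  proof (intro conjI allI impI)
    fix j assume j: "j < weight (0 # es)"
    have "(case j of 0 \<Rightarrow> 0 | Suc i \<Rightarrow> coeff (st.R es) i) \<in> Wspace (weight (0 # es) - j)"
      using IH j by (cases j) auto
    then have "of_nat (Suc (leading_zeros es)) * coeff (st.R (0 # es)) j \<in> Wspace (weight (0 # es) - j)"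
      unfolding st.coeff_0_recursion using IHl j by (intro W.diff_mem W.sum_list_mem) auto
    then show "coeff (st.R (0 # es)) j \<in> Wspace (weight (0 # es) - j)" by (rule W.of_nat_cancel)
  next
    fix j assume j: "j \<ge> weight (0 # es)"
    have "(\<Sum>w\<leftarrow>st.lower_terms es. coeff (st.R w) j) = (\<Sum>w\<leftarrow>st.lower_terms es. 0)"
      by (rule arg_cong[of _ _ sum_list], rule map_cong) (use IHl j in auto)
    moreover have "(case j of 0 \<Rightarrow> 0 | Suc i \<Rightarrow> coeff (st.R es) i) = 0"
      using IH j by (cases j) auto
    ultimately have "of_nat (Suc (leading_zeros es)) * coeff (st.R (0 # es)) j = 0"
      unfolding st.coeff_0_recursion by (simp add: sum_list_0)
    then show "coeff (st.R (0 # es)) j = 0" by simp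
  qed
qed

lemma zst_mem_Wspace:
  assumes "es \<noteq> []"
  shows "zst es \<in> Wspace (weight es)"
proof (cases "0 < sum_list es")
  case True
  moreover have "0 < weight es" using assms by (cases es) auto
  ultimately show ?thesis using coeff_st_R[OF True] by (metis diff_zero poly_0_coeff_0)
next
  case False
  interpret W: rat_subspace "Wspace (weight es)" by (rule subspace_Wspace)
  obtain es' where es: "es = 0 # es'" using assms False by (cases es) auto
  have "zst v \<in> Wspace (weight es)" if "v \<in> set (st.lower_terms es')" for v
    using coeff_st_R[of v] st_lower_terms_nonpure[OF that] es by (auto simp: poly_0_coeff_0)
  then have "of_nat (Suc (leading_zeros es')) * zst (0 # es') \<in> Wspace (weight es)"
    unfolding st.value_0_recursion by (intro W.minus_mem W.sum_list_mem)
  then show ?thesis unfolding es by (rule W.of_nat_cancel[of _ "zst (0 # es')", unfolded es])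
qed

lemma zsh_mem_Wspace: "es \<noteq> [] \<Longrightarrow> zsh es \<in> Wspace (weight es)"
  using zsh_mem_Zspace Zspace_subset_Wspace by blast

text \<open>In the comparison of the regularizations, the term for \<open>k = 0\<close> is the harmonic value, and the terms
  for \<open>k > 0\<close> are products of two values of positive weight.\<close>

lemma zsh_cong_zst:
  assumes "0 < sum_list es"
  shows "zsh es - zst es \<in> Pspace (weight es)"
proof -
  interpret P: rat_subspace "Pspace (weight es)" by (rule subspace_Pspace)
  interpret W: rat_subspace "Wspace l" for l by (rule subspace_Wspace)
  let ?c = "coeff (st.R es)" and ?d = "degree (st.R es)"
  have poly_sum_list: "poly (\<Sum>w\<leftarrow>ws. sh.R w) 0 = (\<Sum>w\<leftarrow>ws. zsh w)" for ws by (induction ws) auto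
  have "zsh es = (\<Sum>k\<le>?d. ?c k * (\<Sum>v\<leftarrow>stuffle_power k. zsh v))"
    by (subst sh_R_eq) (simp add: poly_sum poly_sum_list)
  also have "\<dots> = zst es + (\<Sum>k\<in>{1..?d}. ?c k * (\<Sum>v\<leftarrow>stuffle_power k. zsh v))"
  proof -
    have "{..?d} = insert 0 {1..?d}" by auto
    then show ?thesis by (simp add: poly_0_coeff_0)
  qed
  finally have eq: "zsh es - zst es = (\<Sum>k\<in>{1..?d}. ?c k * (\<Sum>v\<leftarrow>stuffle_power k. zsh v))" by simp
  have "?c k * (\<Sum>v\<leftarrow>stuffle_power k. zsh v) \<in> Pspace (weight es)" if "k \<in> {1..?d}" for k
  proof (cases "k < weight es")
    case True
    have "zsh v \<in> Wspace k" if "v \<in> set (stuffle_power k)" for v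
    proof -
      have "weight v = k" by (rule stuffle_power_weight[OF that])
      moreover from this have "v \<noteq> []" using \<open>k \<in> {1..?d}\<close> by auto
      ultimately show ?thesis using zsh_mem_Wspace by blast
    qed
    then have "(\<Sum>v\<leftarrow>stuffle_power k. zsh v) \<in> Wspace k" by (rule W.sum_list_mem)
    then have "?c k * (\<Sum>v\<leftarrow>stuffle_power k. zsh v) \<in> Pspace (weight es - k + k)"
      using coeff_st_R[OF assms] True by (intro Wspace_mult) auto
    then show ?thesis using True by simp
  next
    case False
    then show ?thesis using coeff_st_R[OF assms] by simp
  qed
  then show ?thesis unfolding eq by (rule rat_real.subspace_sum[OF P.subspace_V])
qed

section \<open>Reversal and parity\<close>

text \<open>The harmonic product is the shuffle of the index tuples up to terms of smaller depth. The depth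
  of these terms is at least that of each factor; hence if one factor has depth one, it drops by at most one.\<close>

lemma (in rat_subspace) stuffle_shuffle_mem:
  assumes "\<And>v. weight v = weight u + weight w \<Longrightarrow> length v < length u + length w \<Longrightarrow>
      length u \<le> length v \<Longrightarrow> length w \<le> length v \<Longrightarrow> f v \<in> V"
  shows "(\<Sum>v\<leftarrow>stuffle_list u w. f v) - (\<Sum>v\<leftarrow>shuffle_list u w. f v) \<in> V"
  using assms
proof (induction u w arbitrary: f rule: stuffle_list.induct)
  case (3 a u b w)
  have 1: "(\<Sum>v\<leftarrow>stuffle_list u (b # w). f (a # v)) - (\<Sum>v\<leftarrow>shuffle_list u (b # w). f (a # v)) \<in> V"
    by (rule "3.IH"(1)) (rule "3.prems", auto)
  have 2: "(\<Sum>v\<leftarrow>stuffle_list (a # u) w. f (b # v)) - (\<Sum>v\<leftarrow>shuffle_list (a # u) w. f (b # v)) \<in> V"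
    by (rule "3.IH"(2)) (rule "3.prems", auto)
  have 3: "(\<Sum>v\<leftarrow>stuffle_list u w. f (Suc (a + b) # v)) \<in> V"
  proof (rule sum_list_mem)
    fix v assume v: "v \<in> set (stuffle_list u w)"
    show "f (Suc (a + b) # v) \<in> V"
      by (rule "3.prems") (use stuffle_weight[OF v] stuffle_length[OF v] stuffle_length_le[OF v] in auto)
  qed
  show ?case using add_mem[OF add_mem[OF 1 2] 3] by (simp add: o_def algebra_simps)
qed auto

lemma subspace_set_plus:
  assumes "rat_real.subspace S" "rat_real.subspace T"
  shows "rat_real.subspace (S + T)" "S \<subseteq> S + T" "T \<subseteq> S + T"
proof -
  have "S + T = {x + y |x y. x \<in> S \<and> y \<in> T}" by (auto simp: set_plus_def)
  then show "rat_real.subspace (S + T)" using rat_real.subspace_sums[OF assms] by simp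
  show "S \<subseteq> S + T" "T \<subseteq> S + T"
    using set_plus_intro[of _ S 0 T] set_plus_intro[of 0 S _ T] rat_real.subspace_0 assms by fastforce+
qed

lemma subspace_set_sum:
  assumes "finite A" "\<And>d. d \<in> A \<Longrightarrow> rat_real.subspace (S d)"
  shows "rat_real.subspace (\<Sum>d\<in>A. S d) \<and> (\<forall>d\<in>A. S d \<subseteq> (\<Sum>d\<in>A. S d))"
  using assms
proof (induction A rule: finite_induct)
  case empty
  have "(0 :: real set) = {0}" by (simp add: set_zero)
  then show ?case by (simp add: rat_real.subspace_single_0)
next
  case (insert d A)
  then show ?case using subspace_set_plus[of "S d" "\<Sum>d\<in>A. S d"] by auto blast
qed

text \<open>The reversal congruence is proved for the shuffle type, whose values have exact depth; its insertion
  hypothesis is the harmonic product with a factor of depth one. The harmonic type follows because both types agree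
  modulo the subspace. For powers of \<open>y\<close> this agreement needs an argument of its own: by the product of \<open>y\<close>
  with \<open>y\<^bsup>n-1\<^esup>\<close>, the harmonic value is a combination of values of depth \<open>n - 1\<close>. For the parity
  statement the antipode is applied to index tuples, where the harmonic product is a shuffle product up to
  smaller depth; it yields the sign \<open>(-1)\<^bsup>n-1\<^esup>\<close>, which is opposite to that of the
  reversal if \<open>l + n\<close> is odd, and then twice the value vanishes.\<close>

lemma reversal_and_parity:
  assumes n: "length es = n" "n \<ge> 1" and l: "weight es = l"
    and z: "\<zeta> = zst \<or> \<zeta> = zsh"
  shows "\<zeta> es - (-1) ^ (l - 1) * \<zeta> (rev es) \<in> Zspace l (n - 1) + Pspace l"
    and "odd (l + n) \<Longrightarrow> \<zeta> es \<in> Zspace_less l n + Pspace l"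
proof -
  define V where "V = Zspace l (n - 1) + Pspace l"
  define V' where "V' = Zspace_less l n + Pspace l"
  have subZ: "rat_real.subspace (Zspace l d)" for d
    using rat_subspace.subspace_V[OF subspace_Zspace] .
  have subP: "rat_real.subspace (Pspace l)"
    using rat_subspace.subspace_V[OF subspace_Pspace] .
  have less: "rat_real.subspace (Zspace_less l n)" "\<And>d. 1 \<le> d \<Longrightarrow> d < n \<Longrightarrow> Zspace l d \<subseteq> Zspace_less l n"
    using subspace_set_sum[of "{1..<n}" "Zspace l"] subZ by (auto simp: Zspace_less_def)
  interpret V: rat_subspace V
    by standard (simp add: V_def subspace_set_plus subZ subP)
  interpret V': rat_subspace V'
    by standard (simp add: V'_def subspace_set_plus less subP)
  have ZV: "Zspace l (n - 1) \<subseteq> V" and PV: "Pspace l \<subseteq> V"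
    unfolding V_def by (rule subspace_set_plus(2,3)[OF subZ subP])+
  have ZV': "Zspace_less l n \<subseteq> V'" and PV': "Pspace l \<subseteq> V'"
    unfolding V'_def by (rule subspace_set_plus(2,3)[OF less(1) subP])+
  have "Zspace l (n - 1) \<subseteq> Zspace_less l n"
  proof (cases "n = 1")
    case True
    \<comment> \<open>there are no tuples of depth \<open>0\<close>, so \<^term>\<open>Zspace l 0\<close> is the zero space\<close>
    have empty: "{mzv ls |ls. admissible ls \<and> sum_list ls = l \<and> length ls = 0} = {}"
      by (auto simp: admissible_def)
    have "Zspace l (n - 1) = {0}" unfolding Zspace_def True diff_self_eq_0 empty by simp
    then show ?thesis using rat_real.subspace_0[OF less(1)] by simp
  next
    case False
    then show ?thesis using n by (intro less(2)) auto
  qed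
  then have VV': "V \<subseteq> V'" unfolding V_def V'_def by (intro set_plus_mono2) auto

  have lower: "zst v \<in> V" if "weight v = l" "length v = n - 1" "v \<noteq> []" for v
  proof -
    have pos: "0 < sum_list v" using that n l by (cases "v") (auto simp: weight_def)
    have "zsh v \<in> V" using zsh_mem_Zspace[of v] that ZV by auto
    moreover have "zsh v - zst v \<in> V" using zsh_cong_zst[OF pos] that PV by auto
    ultimately have "zsh v - (zsh v - zst v) \<in> V" by (rule V.diff_mem)
    then show ?thesis by simp
  qed
  \<comment> \<open>both types of depth \<open>n\<close> agree modulo \<open>V\<close>\<close>
  have cong: "zsh v - zst v \<in> V" if "weight v = l" "length v = n" for v
  proof (cases "0 < sum_list v")
    case True
    then show ?thesis using zsh_cong_zst[OF True] that PV by auto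
  next
    case False
    moreover have "v \<noteq> []" using that n by auto
    ultimately obtain v' where v: "v = 0 # v'" by (cases v) auto
    have "zst w \<in> V" if w: "w \<in> set (st.lower_terms v')" for w
    proof (rule lower)
      note * = st_lower_terms_nonpure[OF w]
      show "weight w = l" using * v \<open>weight v = l\<close> by simp
      then have "length w < n" using *(1) False \<open>weight v = l\<close> \<open>length v = n\<close> unfolding weight_def by linarith
      then show "length w = n - 1" using * v \<open>length v = n\<close> by simp
      show "w \<noteq> []" using * by auto
    qed
    then have "of_nat (Suc (leading_zeros v')) * zst (0 # v') \<in> V"
      unfolding st.value_0_recursion by (intro V.minus_mem V.sum_list_mem)
    then have "zst v \<in> V" unfolding v by (rule V.of_nat_cancel)
    moreover have "zsh v = 0" using False that n by (intro zsh_pure) auto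
    ultimately show ?thesis by (simp add: V.minus_mem)
  qed
  have prod_st: "zst u * zst w \<in> Pspace l" if "u \<noteq> []" "w \<noteq> []" "weight u + weight w = l" for u w
    using Wspace_mult[OF zst_mem_Wspace zst_mem_Wspace, of u w] that by simp
  have prod_sh: "zsh u * zsh w \<in> Pspace l" if "u \<noteq> []" "w \<noteq> []" "weight u + weight w = l" for u w
    using Wspace_mult[OF zsh_mem_Wspace zsh_mem_Wspace, of u w] that by simp

  have reversal_sh: "zsh es - (-1) ^ (l - 1) * zsh (rev es) \<in> V"
  proof (rule V.reversal_congruence)
    fix u w :: "nat list"
    assume uw: "u \<noteq> []" "w \<noteq> []" "length (exp_word u) + length (exp_word w) = l"
    have "(\<Sum>z\<leftarrow>shuffle_list (exp_word u) (exp_word w). word_ext zsh z) = (\<Sum>v\<leftarrow>shuffle_exponents u w. zsh v)"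
      unfolding exp_word_shuffle_exponents[symmetric] by (simp add: o_def)
    also have "\<dots> = zsh u * zsh w" by (rule sh.value_mult[symmetric])
    also have "\<dots> \<in> Pspace l" by (rule prod_sh) (use uw in \<open>auto simp: weight_def\<close>)
    finally show "(\<Sum>z\<leftarrow>shuffle_list (exp_word u) (exp_word w). word_ext zsh z) \<in> V" using PV by blast
  next
    fix a cs assume *: "Suc (length cs) = n" "a + sum_list cs + n = l"
    show "(\<Sum>v\<leftarrow>shuffle_list [a] cs. zsh v) \<in> V"
    proof (cases "cs = []")
      case True
      show ?thesis
      proof (cases a)
        case 0
        then show ?thesis using True by simp
      next
        case (Suc e)
        have "mzv [l] \<in> Pspace l"
          unfolding Pspace_def by (rule rat_real.span_base, rule UnI2) (use * True Suc in auto)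
        then show ?thesis using True Suc * PV sh.R_adm[of e "[]"] by auto
      qed
    next
      case False
      have "(\<Sum>v\<leftarrow>stuffle_list [a] cs. zst v) - (\<Sum>v\<leftarrow>shuffle_list [a] cs. zst v) \<in> V"
      proof (rule V.stuffle_shuffle_mem)
        fix v assume v: "weight v = weight [a] + weight cs" "length v < length [a] + length cs"
          "length [a] \<le> length v" "length cs \<le> length v"
        show "zst v \<in> V" by (rule lower) (use v * in \<open>auto simp: weight_def\<close>)
      qed
      moreover have "(\<Sum>v\<leftarrow>stuffle_list [a] cs. zst v) \<in> V"
        unfolding st.value_mult[symmetric]
        by (rule set_mp[OF PV], rule prod_st) (use False * in \<open>auto simp: weight_def\<close>)
      ultimately have "(\<Sum>v\<leftarrow>shuffle_list [a] cs. zst v) \<in> V"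
        using V.diff_mem by fastforce
      moreover have "(\<Sum>v\<leftarrow>shuffle_list [a] cs. zsh v - zst v) \<in> V"
      proof (rule V.sum_list_mem, rule cong)
        fix v assume "v \<in> set (shuffle_list [a] cs)"
        then have "mset v = mset (a # cs)" by (auto dest: mset_shuffle_list)
        then have "length v = Suc (length cs)" "sum_list v = a + sum_list cs"
          by (metis length_Cons mset_eq_length, metis sum_mset_sum_list sum_list.Cons)
        then show "weight v = l" "length v = n" using * by (auto simp: weight_def)
      qed
      ultimately have "(\<Sum>v\<leftarrow>shuffle_list [a] cs. zst v) + (\<Sum>v\<leftarrow>shuffle_list [a] cs. zsh v - zst v) \<in> V"
        by (rule V.add_mem)
      then show ?thesis by (simp add: sum_list_subtractf)
    qed
  qed (use n l in \<open>auto simp: weight_def\<close>)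
  have weight_rev: "weight (rev es) = l" "length (rev es) = n" using n l by (auto simp: weight_def)
  have reversal_st: "zst es - (-1) ^ (l - 1) * zst (rev es) \<in> V"
  proof -
    have "(zsh es - (-1) ^ (l - 1) * zsh (rev es)) - (zsh es - zst es)
        + (-1) ^ (l - 1) * (zsh (rev es) - zst (rev es)) \<in> V"
      by (intro V.add_mem V.diff_mem V.sign_mem reversal_sh cong) (use n l weight_rev in auto)
    then show ?thesis by (simp add: algebra_simps)
  qed
  show "\<zeta> es - (-1) ^ (l - 1) * \<zeta> (rev es) \<in> Zspace l (n - 1) + Pspace l"
    using z reversal_st reversal_sh by (auto simp: V_def)

  assume odd: "odd (l + n)"
  have "zst es - (-1) ^ (length es - 1) * zst (rev es) \<in> V'"
  proof (rule V'.shuffle_antipode)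
    fix u w assume uw: "u \<noteq> []" "w \<noteq> []" "mset (u @ w) = mset es"
    have "length (u @ w) = length es" "sum_list (u @ w) = sum_list es"
      using uw(3) by (metis mset_eq_length, metis sum_mset_sum_list)
    then have sum: "length u + length w = n" "weight u + weight w = l"
      using n l by (auto simp: weight_def)
    have "(\<Sum>v\<leftarrow>stuffle_list u w. zst v) - (\<Sum>v\<leftarrow>shuffle_list u w. zst v) \<in> V'"
    proof (rule V'.stuffle_shuffle_mem)
      fix v assume v: "weight v = weight u + weight w" "length v < length u + length w" "length u \<le> length v"
      have pos: "0 < sum_list v" using v sum n l by (auto simp: weight_def)
      have "v \<noteq> []" using v uw by auto
      then have "zsh v \<in> V'" using zsh_mem_Zspace[of v] less(2)[of "length v"] v sum ZV'
        by (cases v) auto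
      moreover have "zsh v - zst v \<in> V'" using zsh_cong_zst[OF pos] v sum PV' by auto
      ultimately have "zsh v - (zsh v - zst v) \<in> V'" by (rule V'.diff_mem)
      then show "zst v \<in> V'" by simp
    qed
    moreover have "(\<Sum>v\<leftarrow>stuffle_list u w. zst v) \<in> V'"
      unfolding st.value_mult[symmetric]
      by (rule set_mp[OF PV'], rule prod_st) (use uw sum in auto)
    ultimately show "(\<Sum>v\<leftarrow>shuffle_list u w. zst v) \<in> V'"
      using V'.diff_mem by fastforce
  qed (use n in auto)
  moreover have "zst es - (-1) ^ (l - 1) * zst (rev es) \<in> V'" using reversal_st VV' by blast
  ultimately have sum: "(zst es - (-1) ^ (n - 1) * zst (rev es)) + (zst es - (-1) ^ (l - 1) * zst (rev es)) \<in> V'"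
    unfolding n(1) by (rule V'.add_mem)
  have "l \<ge> 1" using n l by (auto simp: weight_def)
  then have "even (n - 1) \<longleftrightarrow> odd (l - 1)" using odd n(2) by presburger
  then have "(-1 :: real) ^ (n - 1) = - ((-1) ^ (l - 1))"
    by (cases "even (n - 1)") auto
  with sum have "of_nat (Suc 1) * zst es \<in> V'" by (simp add: algebra_simps)
  then have st: "zst es \<in> V'" by (rule V'.of_nat_cancel)
  have "zsh es - zst es \<in> V'" using cong[of es] n l VV' by auto
  then have "zst es + (zsh es - zst es) \<in> V'" using st by (intro V'.add_mem)
  then show "\<zeta> es \<in> Zspace_less l n + Pspace l"
    using st z by (auto simp: V'_def)
qed

theorem theorem1p1:
  fixes ls :: "nat list" and l n :: nat and \<zeta> :: "nat list \<Rightarrow> real"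
  assumes "n \<ge> 1" and "length ls = n" and "\<forall>k\<in>set ls. k \<ge> 1"
    and "l = sum_list ls"
    and "\<zeta> \<in> {zeta_harmonic, zeta_shuffle}"
  shows "cong_mod (\<zeta> ls) ((-1) ^ (l - 1) * \<zeta> (rev ls)) (Zspace l (n - 1) + Pspace l)
    \<and> (odd (l + n) \<longrightarrow> cong_mod (\<zeta> ls) 0 (Zspace_less l n + Pspace l))"
proof -
  define es where "es = map (\<lambda>k. k - 1) ls"
  have ls: "ls = map Suc es" using assms(3) by (auto simp: es_def o_def intro!: map_idI[symmetric])
  have w: "weight es = l" unfolding assms(4) ls by (induction es) auto
  have n: "length es = n" using assms(2) ls by simp
  have "(\<lambda>es. \<zeta> (map Suc es)) = zst \<or> (\<lambda>es. \<zeta> (map Suc es)) = zsh"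
    using assms(5) zeta_harmonic_eq zeta_shuffle_eq by fastforce
  from reversal_and_parity[OF n assms(1) w this] show ?thesis
    by (simp add: cong_mod_def ls rev_map)
qed

end
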